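(* In the bifurcating autoregressive (BAR) model, assume that the distribution $\nu$ of the ancestor $X_1$ has finite moments of all orders. Then $((\hat\sigma_r^2,\hat\rho_r),r\in\mathbb N)$ is a strongly consistent estimator of $(\sigma^2,\rho)$, i.e. $(\hat\sigma_r^2,\hat\rho_r)\to(\sigma^2,\rho)$ almost surely as $r\to\infty$.
   Context: Tree. $\mathbb T=\mathbb N^*=\{1,2,\dots\}$ is the binary tree (vertex $n$ has daughters $2n$, $2n+1$); $\mathbb T_r=\{1,\dots,2^{r+1}-1\}$ is the set of the first $r+1$ generations. BAR model. $X_1$ has distribution $\nu$ on $\mathbb R$ and for all $n\ge1$, $$X_{2n}=\alpha_0X_n+\beta_0+\varepsilon_{2n},\qquad X_{2n+1}=\alpha_1X_n+\beta_1+\varepsilon_{2n+1},$$ where $\alpha_0,\alpha_1\in(-1,1)$, $\beta_0,\beta_1\in\mathbb R$, and $((\varepsilon_{2n},\varepsilon_{2n+1}),n\ge1)$ is a sequence, independent of $X_1$, of i.i.d. centered bivariate Gaussian vectors with covariance matrix $\sigma^2\begin{pmatrix}1&\rho\\\rho&1\end{pmatrix}$, $\sigma^2>0$, $\rho\in(-1,1)$. Estimators. For $\varepsilon\in\{0,1\}$, $$\hat\alpha_\varepsilon^r=\frac{|\mathbb T_r|^{-1}\sum_{i\in\mathbb T_r}X_iX_{2i+\varepsilon}-\big(|\mathbb T_r|^{-1}\sum_{i\in\mathbb T_r}X_i\big)\big(|\mathbb T_r|^{-1}\sum_{i\in\mathbb T_r}X_{2i+\varepsilon}\big)}{|\mathbb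 T_r|^{-1}\sum_{i\in\mathbb T_r}X_i^2-\big(|\mathbb T_r|^{-1}\sum_{i\in\mathbb T_r}X_i\big)^2},$$ $$\hat\beta_\varepsilon^r=|\mathbb T_r|^{-1}\sum_{i\in\mathbb T_r}X_{2i+\varepsilon}-\hat\alpha_\varepsilon^r|\mathbb T_r|^{-1}\sum_{i\in\mathbb T_r}X_i .$$ The residues are $\hat\varepsilon_{2n}=X_{2n}-\hat\alpha_0^rX_n-\hat\beta_0^r$ and $\hat\varepsilon_{2n+1}=X_{2n+1}-\hat\alpha_1^rX_n-\hat\beta_1^r$ ($n\in\mathbb T_r$), and $$\hat\sigma_r^2=\frac1{2|\mathbb T_r|}\sum_{i\in\mathbb T_r}(\hat\varepsilon_{2i}^2+\hat\varepsilon_{2i+1}^2),\qquad\hat\rho_r=\frac1{\hat\sigma_r^2|\mathbb T_r|}\sum_{i\in\mathbb T_r}\hat\varepsilon_{2i}\hat\varepsilon_{2i+1}.$$ (Quotients are given arbitrary values where a denominator vanishes.) *)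

theory Defs
  imports "HOL-Probability.Probability"
begin

section \<open>Gaussian vectors\<close>

text \<open>A real Gaussian variable may be degenerate (almost surely constant), so that the linear
  combinations below need no non-degeneracy condition.\<close>

definition gaussian_rv :: "'a measure \<Rightarrow> ('a \<Rightarrow> real) \<Rightarrow> bool" where
  "gaussian_rv M Y \<longleftrightarrow>
     Y \<in> borel_measurable M \<and>
     ((\<exists>\<mu> \<sigma>. \<sigma> > 0 \<and> distributed M lborel Y (normal_density \<mu> \<sigma>)) \<or> (\<exists>\<mu>. AE \<omega> in M. Y \<omega> = \<mu>))"

definition gaussian_vector ::
  "'a measure \<Rightarrow> ('a \<Rightarrow> real ^ 'n) \<Rightarrow> real ^ 'n \<Rightarrow> real ^ 'n ^ 'n \<Rightarrow> bool" where
  "gaussian_vector M Z m S \<longleftrightarrow>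
     Z \<in> borel_measurable M \<and>
     (\<forall>u. gaussian_rv M (\<lambda>\<omega>. u \<bullet> Z \<omega>)) \<and>
     (\<forall>i. (\<integral>\<omega>. Z \<omega> $ i \<partial>M) = m $ i) \<and>
     (\<forall>i j. (\<integral>\<omega>. (Z \<omega> $ i - m $ i) * (Z \<omega> $ j - m $ j) \<partial>M) = S $ i $ j)"

section \<open>The bifurcating autoregressive model\<close>

text \<open>Vertices are positive integers: \<open>X 0\<close>, \<open>eps 0\<close> and \<open>eps 1\<close> play no role.
  The library's \<open>indep_var\<close> needs both variables to have the same type, so the independence of
  the initial value and the whole noise process is stated for the events they generate.\<close>

definition noise :: "(nat \<Rightarrow> 'a \<Rightarrow> real) \<Rightarrow> nat \<Rightarrow> 'a \<Rightarrow> real ^ 2" where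
  "noise eps n \<omega> = vector [eps (2 * n) \<omega>, eps (2 * n + 1) \<omega>]"

locale bar_model = prob_space M
  for M :: "'a measure" +
  fixes \<nu> :: "real measure"
    and X eps :: "nat \<Rightarrow> 'a \<Rightarrow> real"
    and \<alpha>\<^sub>0 \<alpha>\<^sub>1 \<beta>\<^sub>0 \<beta>\<^sub>1 \<sigma>2 \<rho> :: real
  assumes \<alpha>\<^sub>0: "-1 < \<alpha>\<^sub>0" "\<alpha>\<^sub>0 < 1"
    and \<alpha>\<^sub>1: "-1 < \<alpha>\<^sub>1" "\<alpha>\<^sub>1 < 1"
    and \<sigma>2: "\<sigma>2 > 0"
    and \<rho>: "-1 < \<rho>" "\<rho> < 1"
    and X_1_measurable: "X 1 \<in> borel_measurable M"
    and X_1_distr: "distr M borel (X 1) = \<nu>"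
    and X_even: "\<And>n \<omega>. n \<ge> 1 \<Longrightarrow> \<omega> \<in> space M \<Longrightarrow>
                   X (2 * n) \<omega> = \<alpha>\<^sub>0 * X n \<omega> + \<beta>\<^sub>0 + eps (2 * n) \<omega>"
    and X_odd: "\<And>n \<omega>. n \<ge> 1 \<Longrightarrow> \<omega> \<in> space M \<Longrightarrow>
                   X (2 * n + 1) \<omega> = \<alpha>\<^sub>1 * X n \<omega> + \<beta>\<^sub>1 + eps (2 * n + 1) \<omega>"
    and noise_gaussian: "\<And>n. n \<ge> 1 \<Longrightarrow>
          gaussian_vector M (noise eps n) 0 (\<sigma>2 *\<^sub>R vector [vector [1, \<rho>], vector [\<rho>, 1]])"
    and noise_indep: "indep_vars (\<lambda>_. borel) (noise eps) {1..}"
    and noise_indep_X_1: "indep_set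
          {X 1 -` A \<inter> space M | A. A \<in> sets borel}
          {(\<lambda>\<omega>. \<lambda>n\<in>{1..}. noise eps n \<omega>) -` B \<inter> space M | B. B \<in> sets (Pi\<^sub>M {1..} (\<lambda>_. borel))}"

section \<open>Estimators\<close>

text \<open>The estimators are functions of the observed values \<open>x :: nat \<Rightarrow> real\<close> on the tree.
  A quotient whose denominator vanishes takes a value supplied as a parameter:
  \<open>a e\<close> for the slope estimator with index \<open>e \<in> {0, 1}\<close>, and \<open>b\<close> for the correlation
  estimator.\<close>

definition tree :: "nat \<Rightarrow> nat set" where
  "tree r = {1..2 ^ (r + 1) - 1}"

definition tree_avg :: "nat \<Rightarrow> (nat \<Rightarrow> real) \<Rightarrow> real" where
  "tree_avg r f = (\<Sum>i\<in>tree r. f i) / real (card (tree r))"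

definition quotient_or :: "real \<Rightarrow> real \<Rightarrow> real \<Rightarrow> real" where
  "quotient_or d p q = (if q = 0 then d else p / q)"

definition alpha_hat :: "(nat \<Rightarrow> real) \<Rightarrow> nat \<Rightarrow> nat \<Rightarrow> (nat \<Rightarrow> real) \<Rightarrow> real" where
  "alpha_hat a e r x = quotient_or (a e)
     (tree_avg r (\<lambda>i. x i * x (2 * i + e)) - tree_avg r x * tree_avg r (\<lambda>i. x (2 * i + e)))
     (tree_avg r (\<lambda>i. (x i)\<^sup>2) - (tree_avg r x)\<^sup>2)"

definition beta_hat :: "(nat \<Rightarrow> real) \<Rightarrow> nat \<Rightarrow> nat \<Rightarrow> (nat \<Rightarrow> real) \<Rightarrow> real" where
  "beta_hat a e r x = tree_avg r (\<lambda>i. x (2 * i + e)) - alpha_hat a e r x * tree_avg r x"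

text \<open>\<open>residue a e r x n\<close> is the residue at vertex \<open>2 * n + e\<close>.\<close>

definition residue :: "(nat \<Rightarrow> real) \<Rightarrow> nat \<Rightarrow> nat \<Rightarrow> (nat \<Rightarrow> real) \<Rightarrow> nat \<Rightarrow> real" where
  "residue a e r x n = x (2 * n + e) - alpha_hat a e r x * x n - beta_hat a e r x"

definition sigma2_hat :: "(nat \<Rightarrow> real) \<Rightarrow> nat \<Rightarrow> (nat \<Rightarrow> real) \<Rightarrow> real" where
  "sigma2_hat a r x =
     (\<Sum>i\<in>tree r. (residue a 0 r x i)\<^sup>2 + (residue a 1 r x i)\<^sup>2) / (2 * real (card (tree r)))"

definition rho_hat :: "(nat \<Rightarrow> real) \<Rightarrow> real \<Rightarrow> nat \<Rightarrow> (nat \<Rightarrow> real) \<Rightarrow> real" where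
  "rho_hat a b r x = quotient_or b
     (\<Sum>i\<in>tree r. residue a 0 r x i * residue a 1 r x i)
     (sigma2_hat a r x * real (card (tree r)))"

end

theory Submission
  imports Defs
begin

text \<open>As long as the empirical variance \<open>V\<close> of \<open>X\<close> over the tree is nonzero, the average of a product
  of residues is the empirical covariance of the corresponding noises minus \<open>C * C' / V\<close>, where
  \<open>C\<close> and \<open>C'\<close> are the empirical covariances of \<open>X\<close> with these noises. The noises, their
  centred products and their products with \<open>X\<close> are square integrable orthogonal sequences with
  bounded second moments, so the second moments of their averages over \<open>tree r\<close> are \<open>O(2 ^ -r)\<close> and
  hence summable: these averages tend to \<open>0\<close> almost surely. What remains is pathwise: by
  the model equations the averages of \<open>X\<close> and of its square satisfy affine recursions in \<open>r\<close> with
  convergent coefficients, hence converge, and by Jensen's inequality the limit of \<open>V\<close> is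
  at least \<open>\<sigma>2\<close>.\<close>

section \<open>Averages over the tree\<close>

lemma finite_tree [simp]: "finite (tree r)"
  by (simp add: tree_def)

lemma real_card_tree: "real (card (tree r)) = 2 ^ (r + 1) - 1"
  by (simp add: tree_def of_nat_diff)

lemma card_tree_ge: "2 ^ r \<le> real (card (tree r))"
  by (simp add: real_card_tree)

lemma card_tree_pos: "0 < real (card (tree r))"
  by (rule less_le_trans[OF _ card_tree_ge]) simp

lemma tree_avg_add: "tree_avg r (\<lambda>i. f i + g i) = tree_avg r f + tree_avg r g"
  by (simp add: tree_avg_def sum.distrib add_divide_distrib)

lemma tree_avg_diff: "tree_avg r (\<lambda>i. f i - g i) = tree_avg r f - tree_avg r g"
  by (simp add: tree_avg_def sum_subtractf diff_divide_distrib)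

lemma tree_avg_cmult: "tree_avg r (\<lambda>i. c * f i) = c * tree_avg r f"
  by (simp add: tree_avg_def sum_distrib_left)

lemma tree_avg_const: "tree_avg r (\<lambda>i. c) = c"
  using card_tree_pos[of r] by (auto simp: tree_avg_def)

lemmas tree_avg_linear = tree_avg_add tree_avg_diff tree_avg_cmult tree_avg_const

lemma tree_avg_cong: "(\<And>i. i \<in> tree r \<Longrightarrow> f i = g i) \<Longrightarrow> tree_avg r f = tree_avg r g"
  by (simp add: tree_avg_def)

text \<open>Every vertex except the root is the daughter of exactly one vertex, and the mothers of
  the non-root vertices of \<open>tree (Suc r)\<close> are the vertices of
  \<open>tree r\<close>.\<close>

lemma sum_tree_Suc:
  fixes g :: "nat \<Rightarrow> 'b :: comm_monoid_add"
  shows "sum g (tree (Suc r)) = g 1 + (\<Sum>i\<in>tree r. g (2 * i) + g (2 * i + 1))"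
proof -
  have *: "(\<Sum>i=1..2 * n + 1. g i) = g 1 + (\<Sum>i=1..n. g (2 * i) + g (2 * i + 1))" for n
    by (induction n) (simp_all add: add_ac)
  have "tree (Suc r) = {1..2 * (2 ^ (r + 1) - 1) + 1}"
  proof -
    \<comment> \<open>Subtraction of naturals is truncated: at \<open>t = 0\<close> the two sides
      would be 0 and 1, hence the bound on \<open>t\<close>.\<close>
    have "1 \<le> t \<Longrightarrow> 2 * (2 * t) - 1 = 2 * (2 * t - 1) + 1" for t :: nat
      by presburger
    from this[of "2 ^ r"] have "2 ^ (Suc r + 1) - 1 = 2 * (2 ^ (r + 1) - 1) + (1::nat)"
      by simp
    then show ?thesis unfolding tree_def by simp
  qed
  then show ?thesis
    by (simp only: * tree_def)
qed

text \<open>The tree doubles at each generation up to the root, so this ratio tends to 1/2; in the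
  limit it turns the sum over two daughters into their mean.\<close>

definition growth :: "nat \<Rightarrow> real" where
  "growth r = real (card (tree r)) / real (card (tree (Suc r)))"

lemma tree_avg_Suc:
  "tree_avg (Suc r) g = growth r * tree_avg r (\<lambda>i. g (2 * i) + g (2 * i + 1))
     + g 1 / real (card (tree (Suc r)))"
  using card_tree_pos[of r] unfolding tree_avg_def growth_def sum_tree_Suc
  by (simp add: add_divide_distrib)

lemma inverse_card_tree_tendsto: "(\<lambda>r. c / real (card (tree r))) \<longlonglongrightarrow> 0"
proof (rule Lim_null_comparison)
  show "eventually (\<lambda>r. norm (c / real (card (tree r))) \<le> \<bar>c\<bar> * (1 / 2) ^ r) sequentially"
    using divide_left_mono[OF card_tree_ge, of "\<bar>c\<bar>"] card_tree_pos
    by (intro always_eventually allI) (simp add: power_one_over)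
  show "(\<lambda>r. \<bar>c\<bar> * (1 / 2) ^ r) \<longlonglongrightarrow> 0"
    by (intro tendsto_mult_right_zero LIMSEQ_realpow_zero) auto
qed

lemma growth_tendsto: "growth \<longlonglongrightarrow> 1 / 2"
proof -
  have "growth = (\<lambda>r. 1 / 2 - (1 / 2) / real (card (tree (Suc r))))"
  proof
    show "growth r = 1 / 2 - (1 / 2) / real (card (tree (Suc r)))" for r
      using card_tree_pos[of "Suc r"] by (simp add: growth_def real_card_tree field_simps)
  qed
  moreover have "(\<lambda>r. 1 / 2 - (1 / 2) / real (card (tree (Suc r)))) \<longlonglongrightarrow> 1 / 2 - 0"
    by (intro tendsto_diff tendsto_const filterlim_compose[OF inverse_card_tree_tendsto filterlim_Suc])
  ultimately show ?thesis by simp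
qed

section \<open>Perturbed affine recursions\<close>

lemma perturbed_contraction_tendsto_0:
  fixes v w :: "nat \<Rightarrow> real"
  assumes k: "0 \<le> k" "k < 1"
    and step: "eventually (\<lambda>r. v (Suc r) \<le> k * v r + w r) sequentially"
    and nonneg: "\<And>r. 0 \<le> v r"
    and w: "w \<longlonglongrightarrow> 0"
  shows "v \<longlonglongrightarrow> 0"
proof (rule order_tendstoI)
  show "eventually (\<lambda>r. y < v r) sequentially" if "y < 0" for y
    using less_le_trans[OF that nonneg] by simp
next
  fix y :: real assume y: "0 < y"
  \<comment> \<open>With this threshold, y / 2 is the fixed point of t \<mapsto> k * t + (1 - k) *
    (y / 2). From some rank on, \<open>v\<close> is therefore at most y / 2 plus a geometrically
    decaying term.\<close>
  have "eventually (\<lambda>r. w r < (1 - k) * (y / 2)) sequentially"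
    using k y by (intro order_tendstoD(2)[OF w]) simp
  from eventually_conj[OF step this]
  have "\<exists>R. \<forall>r\<ge>R. v (Suc r) \<le> k * v r + w r \<and> w r < (1 - k) * (y / 2)"
    by (simp only: eventually_sequentially)
  then obtain R where R: "\<And>r. r \<ge> R \<Longrightarrow> v (Suc r) \<le> k * v r + w r"
      "\<And>r. r \<ge> R \<Longrightarrow> w r < (1 - k) * (y / 2)"
    by auto
  have bound: "v (n + R) \<le> k ^ n * v R + y / 2" for n
  proof (induction n)
    case 0 then show ?case using y by simp
  next
    case (Suc n)
    have "v (Suc (n + R)) \<le> k * v (n + R) + w (n + R)" using R(1)[of "n + R"] by simp
    also have "\<dots> \<le> k * (k ^ n * v R + y / 2) + (1 - k) * (y / 2)"
      using R(2)[of "n + R"] k Suc by (intro add_mono mult_left_mono) simp_all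
    also have "\<dots> = k ^ Suc n * v R + y / 2" by (simp add: field_simps)
    finally show ?case by simp
  qed
  have "(\<lambda>n. k ^ n * v R + y / 2) \<longlonglongrightarrow> 0 * v R + y / 2"
    using k by (intro tendsto_add tendsto_mult tendsto_const LIMSEQ_realpow_zero) auto
  then have "eventually (\<lambda>n. k ^ n * v R + y / 2 < y) sequentially"
    by (rule order_tendstoD(2)) (use y in simp)
  then have "eventually (\<lambda>n. v (n + R) < y) sequentially"
    by eventually_elim (rule le_less_trans[OF bound])
  then show "eventually (\<lambda>n. v n < y) sequentially"
    by (rule eventually_sequentially_seg[THEN iffD1])
qed

text \<open>The limit is the fixed point of the limiting affine map. The distance of
  \<open>u r\<close> to it is eventually contracted by any factor strictly between the modulus of
  \<open>c'\<close> and 1, up to the defect of this point under the r-th map, which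
  vanishes.\<close>

lemma affine_recursion_tendsto:
  fixes u c d :: "nat \<Rightarrow> real"
  assumes rec: "\<And>r. u (Suc r) = c r * u r + d r"
    and c: "c \<longlonglongrightarrow> c'" and d: "d \<longlonglongrightarrow> d'" and c': "\<bar>c'\<bar> < 1"
  shows "u \<longlonglongrightarrow> d' / (1 - c')"
proof -
  define l where "l = d' / (1 - c')"
  obtain k where k: "\<bar>c'\<bar> < k" "k < 1" using c' dense by blast
  have l: "c' * l + d' - l = 0" using c' by (simp add: l_def field_simps)
  have "(\<lambda>r. \<bar>c r * l + d r - l\<bar>) \<longlonglongrightarrow> \<bar>c' * l + d' - l\<bar>"
    by (intro tendsto_rabs tendsto_diff tendsto_add tendsto_mult tendsto_const c d)
  then have w: "(\<lambda>r. \<bar>c r * l + d r - l\<bar>) \<longlonglongrightarrow> 0" using l by simp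
  have "eventually (\<lambda>r. \<bar>c r\<bar> < k) sequentially"
    by (rule order_tendstoD(2)[OF tendsto_rabs[OF c] k(1)])
  then have "eventually (\<lambda>r. \<bar>u (Suc r) - l\<bar> \<le> k * \<bar>u r - l\<bar> + \<bar>c r * l + d r - l\<bar>) sequentially"
  proof eventually_elim
    case (elim r)
    have "\<bar>u (Suc r) - l\<bar> = \<bar>c r * (u r - l) + (c r * l + d r - l)\<bar>"
      by (simp add: rec algebra_simps)
    also have "\<dots> \<le> \<bar>c r\<bar> * \<bar>u r - l\<bar> + \<bar>c r * l + d r - l\<bar>"
      by (rule order_trans[OF abs_triangle_ineq]) (simp add: abs_mult)
    also have "\<bar>c r\<bar> * \<bar>u r - l\<bar> \<le> k * \<bar>u r - l\<bar>" using elim by (intro mult_right_mono) auto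
    finally show ?case by simp
  qed
  then have "(\<lambda>r. \<bar>u r - l\<bar>) \<longlonglongrightarrow> 0"
    using k w by (intro perturbed_contraction_tendsto_0[where k = k, OF _ k(2) _ _ w]) auto
  then show ?thesis
    unfolding l_def[symmetric] tendsto_rabs_zero_iff by (rule LIM_zero_cancel)
qed

section \<open>Pathwise analysis of residues and estimators\<close>

text \<open>A residue is the centred noise minus the error of the slope estimator times the centred
  \<open>x\<close>. The indices \<open>e\<close> and \<open>e'\<close> may coincide, so variances
  and the covariance of the residues are treated at once.\<close>

lemma tree_avg_residue_mult:
  fixes x u u' :: "nat \<Rightarrow> real" and r :: nat
  defines "m \<equiv> tree_avg r x"
  defines "V \<equiv> tree_avg r (\<lambda>i. (x i)\<^sup>2) - m\<^sup>2"
  assumes V: "V \<noteq> 0"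
    and x: "\<And>i. i \<in> tree r \<Longrightarrow> x (2 * i + e) = \<alpha> * x i + \<beta> + u i"
      "\<And>i. i \<in> tree r \<Longrightarrow> x (2 * i + e') = \<alpha>' * x i + \<beta>' + u' i"
  shows "tree_avg r (\<lambda>i. residue a e r x i * residue a e' r x i) =
    tree_avg r (\<lambda>i. u i * u' i) - tree_avg r u * tree_avg r u'
      - (tree_avg r (\<lambda>i. x i * u i) - m * tree_avg r u)
        * (tree_avg r (\<lambda>i. x i * u' i) - m * tree_avg r u') / V"
proof -
  \<comment> \<open>Least squares recovers the affine part exactly: the slope error is the empirical
    covariance of \<open>x\<close> and the noise divided by \<open>V\<close>, and neither the true
    slope nor the true intercept survives in the residue.\<close>
  have res: "(\<forall>i\<in>tree r. residue a e r x i =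
        u i - tree_avg r u - (tree_avg r (\<lambda>i. x i * u i) - m * tree_avg r u) / V * (x i - m))"
    if x: "\<And>i. i \<in> tree r \<Longrightarrow> x (2 * i + e) = \<alpha> * x i + \<beta> + u i" for e \<alpha> \<beta> and u :: "nat \<Rightarrow> real"
  proof -
    have "tree_avg r (\<lambda>i. x (2 * i + e)) = tree_avg r (\<lambda>i. \<alpha> * x i + \<beta> + u i)"
      by (rule tree_avg_cong) (simp add: x)
    then have 1: "tree_avg r (\<lambda>i. x (2 * i + e)) = \<alpha> * m + \<beta> + tree_avg r u"
      by (simp add: tree_avg_linear m_def)
    have "tree_avg r (\<lambda>i. x i * x (2 * i + e)) =
        tree_avg r (\<lambda>i. \<alpha> * (x i)\<^sup>2 + \<beta> * x i + x i * u i)"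
      by (rule tree_avg_cong) (simp only: x, simp add: power2_eq_square algebra_simps)
    then have 2: "tree_avg r (\<lambda>i. x i * x (2 * i + e)) =
        \<alpha> * tree_avg r (\<lambda>i. (x i)\<^sup>2) + \<beta> * m + tree_avg r (\<lambda>i. x i * u i)"
      by (simp add: tree_avg_linear m_def)
    have 3: "alpha_hat a e r x = \<alpha> + (tree_avg r (\<lambda>i. x i * u i) - m * tree_avg r u) / V"
      unfolding alpha_hat_def quotient_or_def 1 2 m_def[symmetric] V_def[symmetric] using V
      by (simp add: field_simps) (simp add: V_def power2_eq_square algebra_simps)
    define Q where "Q = (tree_avg r (\<lambda>i. x i * u i) - m * tree_avg r u) / V"
    have "residue a e r x i = u i - tree_avg r u - Q * (x i - m)" if "i \<in> tree r" for i
      unfolding residue_def beta_hat_def 1 m_def[symmetric] 3 Q_def[symmetric] x[OF that]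
      by algebra
    then show ?thesis unfolding Q_def by blast
  qed
  define C C' where "C = tree_avg r (\<lambda>i. x i * u i) - m * tree_avg r u"
    and "C' = tree_avg r (\<lambda>i. x i * u' i) - m * tree_avg r u'"
  define c c' p p' where "c = C / V" and "c' = C' / V" and "p = tree_avg r u" and "p' = tree_avg r u'"
  have "tree_avg r (\<lambda>i. residue a e r x i * residue a e' r x i) =
      tree_avg r (\<lambda>i. u i * u' i - p' * u i - p * u' i + p * p'
        - c' * (x i * u i) + c' * m * u i - c * (x i * u' i) + c * m * u' i
        + c' * p * x i - c' * p * m + c * p' * x i - c * p' * m
        + c * c' * (x i)\<^sup>2 - 2 * c * c' * m * x i + c * c' * m\<^sup>2)"
  proof (rule tree_avg_cong)
    fix i assume "i \<in> tree r"
    then have r: "residue a e r x i = u i - p - c * (x i - m)"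
        "residue a e' r x i = u' i - p' - c' * (x i - m)"
      using res[of e, OF x(1)] res[of e', OF x(2)]
      unfolding c_def c'_def C_def C'_def p_def p'_def by blast+
    show "residue a e r x i * residue a e' r x i =
        u i * u' i - p' * u i - p * u' i + p * p'
        - c' * (x i * u i) + c' * m * u i - c * (x i * u' i) + c * m * u' i
        + c' * p * x i - c' * p * m + c * p' * x i - c * p' * m
        + c * c' * (x i)\<^sup>2 - 2 * c * c' * m * x i + c * c' * m\<^sup>2"
      unfolding r by algebra
  qed
  \<comment> \<open>Two cross terms with a minus sign and one quadratic term with a plus sign
    remain; each has absolute value that of \<open>C * C' / V\<close>, so together they give a
    single \<open>- C * C' / V\<close>.\<close>
  also have "\<dots> = tree_avg r (\<lambda>i. u i * u' i) - p * p' - c' * C - c * C' + c * c' * V"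
    unfolding tree_avg_linear m_def[symmetric] p_def[symmetric] p'_def[symmetric] C_def C'_def V_def
    by algebra
  also have "c' * C = C * C' / V" unfolding c'_def by simp
  also have "c * C' = C * C' / V" unfolding c_def by simp
  also have "c * c' * V = C * C' / V" unfolding c_def c'_def using V by simp
  finally show ?thesis unfolding C_def C'_def p_def p'_def by simp
qed

text \<open>Averaging the model equations and their squares over both daughters gives affine
  recursions with limiting coefficients \<open>(\<alpha>\<^sub>0 + \<alpha>\<^sub>1) / 2\<close> and
  \<open>(\<alpha>\<^sub>0\<^sup>2 + \<alpha>\<^sub>1\<^sup>2) / 2\<close>, both of modulus below 1.
  The limit of the mean is needed first, since it enters the inhomogeneous term of the second
  recursion.\<close>

lemma bar_variance_tendsto:
  fixes x :: "nat \<Rightarrow> real"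
  assumes \<alpha>: "\<bar>\<alpha>\<^sub>0\<bar> < 1" "\<bar>\<alpha>\<^sub>1\<bar> < 1" and s: "s > 0"
    and x: "\<And>n. n \<ge> 1 \<Longrightarrow> x (2 * n) = \<alpha>\<^sub>0 * x n + \<beta>\<^sub>0 + u n"
      "\<And>n. n \<ge> 1 \<Longrightarrow> x (2 * n + 1) = \<alpha>\<^sub>1 * x n + \<beta>\<^sub>1 + v n"
    and u: "(\<lambda>r. tree_avg r u) \<longlonglongrightarrow> 0" and v: "(\<lambda>r. tree_avg r v) \<longlonglongrightarrow> 0"
    and uu: "(\<lambda>r. tree_avg r (\<lambda>i. (u i)\<^sup>2)) \<longlonglongrightarrow> s"
    and vv: "(\<lambda>r. tree_avg r (\<lambda>i. (v i)\<^sup>2)) \<longlonglongrightarrow> s"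
    and xu: "(\<lambda>r. tree_avg r (\<lambda>i. x i * u i)) \<longlonglongrightarrow> 0"
    and xv: "(\<lambda>r. tree_avg r (\<lambda>i. x i * v i)) \<longlonglongrightarrow> 0"
  shows "\<exists>m V. V > 0 \<and> (\<lambda>r. tree_avg r x) \<longlonglongrightarrow> m \<and>
    (\<lambda>r. tree_avg r (\<lambda>i. (x i)\<^sup>2) - (tree_avg r x)\<^sup>2) \<longlonglongrightarrow> V"
proof -
  have ge1: "i \<ge> 1" if "i \<in> tree r" for i r using that by (simp add: tree_def)
  have sq: "\<alpha>\<^sub>0\<^sup>2 < 1" "\<alpha>\<^sub>1\<^sup>2 < 1" using \<alpha> by (simp_all add: abs_square_less_1)
  note x' = x(1)[OF ge1] x(2)[OF ge1]
  define a where "a = 1 / 2 * (\<alpha>\<^sub>0 + \<alpha>\<^sub>1)"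
  \<comment> \<open>The zeros keep the shape of the recursion's inhomogeneous term, so that its
    limit can be computed summand by summand: they stand for the two noise averages and the
    contribution of the root. The same holds for \<open>D\<close> below.\<close>
  define m where "m = (1 / 2 * (\<beta>\<^sub>0 + \<beta>\<^sub>1 + 0 + 0) + 0) / (1 - a)"
  have "tree_avg (Suc r) x = growth r * (\<alpha>\<^sub>0 + \<alpha>\<^sub>1) * tree_avg r x
      + (growth r * (\<beta>\<^sub>0 + \<beta>\<^sub>1 + tree_avg r u + tree_avg r v)
         + x 1 / real (card (tree (Suc r))))" for r
  proof -
    have "tree_avg r (\<lambda>i. x (2 * i) + x (2 * i + 1)) =
        tree_avg r (\<lambda>i. (\<alpha>\<^sub>0 + \<alpha>\<^sub>1) * x i + (\<beta>\<^sub>0 + \<beta>\<^sub>1) + u i + v i)"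
      by (rule tree_avg_cong) (simp only: x', simp add: algebra_simps)
    then show ?thesis unfolding tree_avg_Suc by (simp add: tree_avg_linear algebra_simps)
  qed
  then have m: "(\<lambda>r. tree_avg r x) \<longlonglongrightarrow> m"
    unfolding m_def
  proof (rule affine_recursion_tendsto)
    show "(\<lambda>r. growth r * (\<alpha>\<^sub>0 + \<alpha>\<^sub>1)) \<longlonglongrightarrow> a"
      unfolding a_def by (intro tendsto_intros growth_tendsto)
    show "\<bar>a\<bar> < 1" using \<alpha> unfolding a_def by (simp add: abs_if split: if_splits)
    show "(\<lambda>r. growth r * (\<beta>\<^sub>0 + \<beta>\<^sub>1 + tree_avg r u + tree_avg r v)
        + x 1 / real (card (tree (Suc r)))) \<longlonglongrightarrow> 1 / 2 * (\<beta>\<^sub>0 + \<beta>\<^sub>1 + 0 + 0) + 0"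
      by (intro tendsto_intros growth_tendsto u v
          filterlim_compose[OF inverse_card_tree_tendsto filterlim_Suc])
  qed
  define A where "A = 1 / 2 * (\<alpha>\<^sub>0\<^sup>2 + \<alpha>\<^sub>1\<^sup>2)"
  define D where "D = 1 / 2 * (2 * (\<alpha>\<^sub>0 * \<beta>\<^sub>0 + \<alpha>\<^sub>1 * \<beta>\<^sub>1) * m + (\<beta>\<^sub>0\<^sup>2 + \<beta>\<^sub>1\<^sup>2)
      + 2 * \<alpha>\<^sub>0 * 0 + 2 * \<alpha>\<^sub>1 * 0 + 2 * \<beta>\<^sub>0 * 0 + 2 * \<beta>\<^sub>1 * 0 + s + s) + 0"
  define q where "q = D / (1 - A)"
  have A: "0 \<le> A" "A < 1" using sq unfolding A_def by simp_all
  have "tree_avg (Suc r) (\<lambda>i. (x i)\<^sup>2) = growth r * (\<alpha>\<^sub>0\<^sup>2 + \<alpha>\<^sub>1\<^sup>2) * tree_avg r (\<lambda>i. (x i)\<^sup>2)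
      + (growth r * (2 * (\<alpha>\<^sub>0 * \<beta>\<^sub>0 + \<alpha>\<^sub>1 * \<beta>\<^sub>1) * tree_avg r x + (\<beta>\<^sub>0\<^sup>2 + \<beta>\<^sub>1\<^sup>2)
           + 2 * \<alpha>\<^sub>0 * tree_avg r (\<lambda>i. x i * u i) + 2 * \<alpha>\<^sub>1 * tree_avg r (\<lambda>i. x i * v i)
           + 2 * \<beta>\<^sub>0 * tree_avg r u + 2 * \<beta>\<^sub>1 * tree_avg r v
           + tree_avg r (\<lambda>i. (u i)\<^sup>2) + tree_avg r (\<lambda>i. (v i)\<^sup>2))
         + (x 1)\<^sup>2 / real (card (tree (Suc r))))" for r
  proof -
    have "tree_avg r (\<lambda>i. (x (2 * i))\<^sup>2 + (x (2 * i + 1))\<^sup>2) =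
        tree_avg r (\<lambda>i. (\<alpha>\<^sub>0\<^sup>2 + \<alpha>\<^sub>1\<^sup>2) * (x i)\<^sup>2 + 2 * (\<alpha>\<^sub>0 * \<beta>\<^sub>0 + \<alpha>\<^sub>1 * \<beta>\<^sub>1) * x i
           + (\<beta>\<^sub>0\<^sup>2 + \<beta>\<^sub>1\<^sup>2) + 2 * \<alpha>\<^sub>0 * (x i * u i) + 2 * \<alpha>\<^sub>1 * (x i * v i)
           + 2 * \<beta>\<^sub>0 * u i + 2 * \<beta>\<^sub>1 * v i + (u i)\<^sup>2 + (v i)\<^sup>2)"
      by (rule tree_avg_cong)
         (simp only: x', simp add: power2_eq_square algebra_simps)
    then show ?thesis unfolding tree_avg_Suc by (simp only: tree_avg_linear, simp only: algebra_simps)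
  qed
  then have q: "(\<lambda>r. tree_avg r (\<lambda>i. (x i)\<^sup>2)) \<longlonglongrightarrow> q"
    unfolding q_def
  proof (rule affine_recursion_tendsto)
    show "(\<lambda>r. growth r * (\<alpha>\<^sub>0\<^sup>2 + \<alpha>\<^sub>1\<^sup>2)) \<longlonglongrightarrow> A"
      unfolding A_def by (intro tendsto_intros growth_tendsto)
    show "\<bar>A\<bar> < 1" using A by simp
    show "(\<lambda>r. growth r * (2 * (\<alpha>\<^sub>0 * \<beta>\<^sub>0 + \<alpha>\<^sub>1 * \<beta>\<^sub>1) * tree_avg r x + (\<beta>\<^sub>0\<^sup>2 + \<beta>\<^sub>1\<^sup>2)
           + 2 * \<alpha>\<^sub>0 * tree_avg r (\<lambda>i. x i * u i) + 2 * \<alpha>\<^sub>1 * tree_avg r (\<lambda>i. x i * v i)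
           + 2 * \<beta>\<^sub>0 * tree_avg r u + 2 * \<beta>\<^sub>1 * tree_avg r v
           + tree_avg r (\<lambda>i. (u i)\<^sup>2) + tree_avg r (\<lambda>i. (v i)\<^sup>2))
         + (x 1)\<^sup>2 / real (card (tree (Suc r)))) \<longlonglongrightarrow> D"
      unfolding D_def
      by (intro tendsto_intros growth_tendsto u v m xu xv uu vv
          filterlim_compose[OF inverse_card_tree_tendsto filterlim_Suc])
  qed
  have "q - m\<^sup>2 > 0"
  proof -
    \<comment> \<open>\<open>y\<close> and \<open>z\<close> are the images of \<open>m\<close> under
      the two noiseless daughter equations. The fixed-point equation for \<open>m\<close> says that
      \<open>m\<close> is their mean, and convexity of the square bounds \<open>m\<^sup>2\<close>.
      The noise variance \<open>s\<close> in \<open>D\<close> makes the final inequality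
      strict.\<close>
    define y where "y = \<alpha>\<^sub>0 * m + \<beta>\<^sub>0"
    define z where "z = \<alpha>\<^sub>1 * m + \<beta>\<^sub>1"
    have "1 - a > 0" using \<alpha> unfolding a_def by (simp add: abs_if split: if_splits)
    then have "1 - a \<noteq> 0" by simp
    moreover have "m = (\<beta>\<^sub>0 + \<beta>\<^sub>1) / 2 / (1 - a)" unfolding m_def by simp
    ultimately have "m * (1 - a) = (\<beta>\<^sub>0 + \<beta>\<^sub>1) / 2"
      by (rule nonzero_eq_divide_eq[THEN iffD1])
    then have "m - a * m = (\<beta>\<^sub>0 + \<beta>\<^sub>1) / 2" by (simp add: algebra_simps)
    moreover have "(y + z) / 2 = a * m + (\<beta>\<^sub>0 + \<beta>\<^sub>1) / 2"
      unfolding y_def z_def a_def by (simp add: field_simps)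
    ultimately have "m = (y + z) / 2" by linarith
    moreover have "((y + z) / 2)\<^sup>2 \<le> (y\<^sup>2 + z\<^sup>2) / 2"
      using zero_le_power2[of "y - z"] by (simp add: power2_eq_square field_simps)
    ultimately have "m\<^sup>2 \<le> (y\<^sup>2 + z\<^sup>2) / 2" by (simp only:)
    also have "\<dots> = A * m\<^sup>2 + D - s"
      unfolding A_def D_def y_def z_def by (simp add: power2_eq_square algebra_simps)
    finally have "(1 - A) * m\<^sup>2 < D" using s by (simp add: algebra_simps)
    then show ?thesis using A unfolding q_def by (simp add: pos_less_divide_eq mult.commute)
  qed
  moreover have "(\<lambda>r. tree_avg r (\<lambda>i. (x i)\<^sup>2) - (tree_avg r x)\<^sup>2) \<longlonglongrightarrow> q - m\<^sup>2"
    by (intro tendsto_diff tendsto_power m q)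
  ultimately show ?thesis using m by blast
qed

text \<open>The limit of \<open>V\<close> is positive, so the slope defaults enter for finitely many
  \<open>r\<close> only; the limit of \<open>sigma2_hat\<close> is positive, so the same is true of
  the correlation default. This is why \<open>a\<close> and \<open>b\<close> may vary with
  \<open>r\<close>.\<close>

lemma bar_estimators_tendsto:
  fixes x :: "nat \<Rightarrow> real" and a :: "nat \<Rightarrow> nat \<Rightarrow> real" and b :: "nat \<Rightarrow> real"
  assumes \<alpha>: "\<bar>\<alpha>\<^sub>0\<bar> < 1" "\<bar>\<alpha>\<^sub>1\<bar> < 1" and s: "s > 0"
    and x: "\<And>n. n \<ge> 1 \<Longrightarrow> x (2 * n) = \<alpha>\<^sub>0 * x n + \<beta>\<^sub>0 + u n"
      "\<And>n. n \<ge> 1 \<Longrightarrow> x (2 * n + 1) = \<alpha>\<^sub>1 * x n + \<beta>\<^sub>1 + v n"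
    and u: "(\<lambda>r. tree_avg r u) \<longlonglongrightarrow> 0" and v: "(\<lambda>r. tree_avg r v) \<longlonglongrightarrow> 0"
    and uu: "(\<lambda>r. tree_avg r (\<lambda>i. (u i)\<^sup>2)) \<longlonglongrightarrow> s"
    and vv: "(\<lambda>r. tree_avg r (\<lambda>i. (v i)\<^sup>2)) \<longlonglongrightarrow> s"
    and uv: "(\<lambda>r. tree_avg r (\<lambda>i. u i * v i)) \<longlonglongrightarrow> s * \<rho>"
    and xu: "(\<lambda>r. tree_avg r (\<lambda>i. x i * u i)) \<longlonglongrightarrow> 0"
    and xv: "(\<lambda>r. tree_avg r (\<lambda>i. x i * v i)) \<longlonglongrightarrow> 0"
  shows "(\<lambda>r. (sigma2_hat (a r) r x, rho_hat (a r) (b r) r x)) \<longlonglongrightarrow> (s, \<rho>)"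
proof -
  have ge1: "i \<ge> 1" if "i \<in> tree r" for i r using that by (simp add: tree_def)
  define V where "V r = tree_avg r (\<lambda>i. (x i)\<^sup>2) - (tree_avg r x)\<^sup>2" for r
  obtain m W where W: "W > 0" "V \<longlonglongrightarrow> W" and m: "(\<lambda>r. tree_avg r x) \<longlonglongrightarrow> m"
    using bar_variance_tendsto[OF \<alpha> s x u v uu vv xu xv] unfolding V_def by blast
  have V: "eventually (\<lambda>r. V r \<noteq> 0) sequentially"
    using order_tendstoD(1)[OF W(2,1)] by eventually_elim simp
  \<comment> \<open>The daughter indices are left arbitrary so that the pairs (0, 0), (1, 1) and (0,
    1) yield both variances and the covariance. The correction term vanishes: its numerator tends to
    0 and its denominator to \<open>W > 0\<close>.\<close>
  have res: "(\<lambda>r. tree_avg r (\<lambda>i. residue (a r) e r x i * residue (a r) e' r x i)) \<longlonglongrightarrow> l"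
    if w: "\<And>n. n \<ge> 1 \<Longrightarrow> x (2 * n + e) = \<alpha> * x n + \<beta> + w n"
      "\<And>n. n \<ge> 1 \<Longrightarrow> x (2 * n + e') = \<alpha>' * x n + \<beta>' + w' n"
      and lim: "(\<lambda>r. tree_avg r w) \<longlonglongrightarrow> 0" "(\<lambda>r. tree_avg r w') \<longlonglongrightarrow> 0"
        "(\<lambda>r. tree_avg r (\<lambda>i. w i * w' i)) \<longlonglongrightarrow> l"
        "(\<lambda>r. tree_avg r (\<lambda>i. x i * w i)) \<longlonglongrightarrow> 0" "(\<lambda>r. tree_avg r (\<lambda>i. x i * w' i)) \<longlonglongrightarrow> 0"
    for e e' w w' l \<alpha> \<beta> \<alpha>' \<beta>'
  proof -
    have "(\<lambda>r. tree_avg r (\<lambda>i. w i * w' i) - tree_avg r w * tree_avg r w'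
      - (tree_avg r (\<lambda>i. x i * w i) - tree_avg r x * tree_avg r w)
        * (tree_avg r (\<lambda>i. x i * w' i) - tree_avg r x * tree_avg r w') / V r)
       \<longlonglongrightarrow> l - 0 * 0 - (0 - m * 0) * (0 - m * 0) / W"
      using W(1) by (intro tendsto_intros lim m W(2)) simp
    then have "(\<lambda>r. tree_avg r (\<lambda>i. w i * w' i) - tree_avg r w * tree_avg r w'
      - (tree_avg r (\<lambda>i. x i * w i) - tree_avg r x * tree_avg r w)
        * (tree_avg r (\<lambda>i. x i * w' i) - tree_avg r x * tree_avg r w') / V r) \<longlonglongrightarrow> l"
      by simp
    moreover have "eventually (\<lambda>r. tree_avg r (\<lambda>i. w i * w' i) - tree_avg r w * tree_avg r w'
      - (tree_avg r (\<lambda>i. x i * w i) - tree_avg r x * tree_avg r w)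
        * (tree_avg r (\<lambda>i. x i * w' i) - tree_avg r x * tree_avg r w') / V r
      = tree_avg r (\<lambda>i. residue (a r) e r x i * residue (a r) e' r x i)) sequentially"
      using V
    proof eventually_elim
      case (elim r)
      show ?case
        unfolding V_def
        by (rule tree_avg_residue_mult[symmetric]) (use elim w ge1 in \<open>auto simp: V_def\<close>)
    qed
    ultimately show ?thesis by (rule Lim_transform_eventually)
  qed
  \<comment> \<open>Brings the even equation to the form 2 * n + e with e = 0.\<close>
  have x0: "x (2 * n + 0) = \<alpha>\<^sub>0 * x n + \<beta>\<^sub>0 + u n" if "n \<ge> 1" for n using x(1)[OF that] by simp
  note r00 = res[OF x0 x0 u u uu[unfolded power2_eq_square] xu xu]
    and r11 = res[OF x(2) x(2) v v vv[unfolded power2_eq_square] xv xv]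
    and r01 = res[OF x0 x(2) u v uv xu xv]
  have sigma2_hat: "sigma2_hat (a r) r x =
      1 / 2 * (tree_avg r (\<lambda>i. residue (a r) 0 r x i * residue (a r) 0 r x i)
        + tree_avg r (\<lambda>i. residue (a r) 1 r x i * residue (a r) 1 r x i))" for r
    by (simp add: sigma2_hat_def tree_avg_def power2_eq_square sum.distrib add_divide_distrib)
  have "(\<lambda>r. sigma2_hat (a r) r x) \<longlonglongrightarrow> 1 / 2 * (s + s)"
    unfolding sigma2_hat by (intro tendsto_intros r00 r11)
  then have S: "(\<lambda>r. sigma2_hat (a r) r x) \<longlonglongrightarrow> s" by simp
  have "(\<lambda>r. tree_avg r (\<lambda>i. residue (a r) 0 r x i * residue (a r) 1 r x i)
      / sigma2_hat (a r) r x) \<longlonglongrightarrow> s * \<rho> / s"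
    using s by (intro tendsto_intros r01 S) auto
  then have "(\<lambda>r. tree_avg r (\<lambda>i. residue (a r) 0 r x i * residue (a r) 1 r x i)
      / sigma2_hat (a r) r x) \<longlonglongrightarrow> \<rho>"
    using s by simp
  moreover have "eventually (\<lambda>r. tree_avg r (\<lambda>i. residue (a r) 0 r x i * residue (a r) 1 r x i)
      / sigma2_hat (a r) r x = rho_hat (a r) (b r) r x) sequentially"
    using order_tendstoD(1)[OF S s]
  proof eventually_elim
    case (elim r)
    then show ?case using card_tree_pos[of r]
      by (auto simp: rho_hat_def quotient_or_def tree_avg_def field_simps)
  qed
  ultimately have "(\<lambda>r. rho_hat (a r) (b r) r x) \<longlonglongrightarrow> \<rho>" by (rule Lim_transform_eventually)
  with S show ?thesis by (rule tendsto_Pair)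
qed

section \<open>Laws of large numbers and fourth moments\<close>

text \<open>By orthogonality only diagonal terms contribute to the second moment of the average,
  which is at most C / |T_r|. As the tree grows exponentially these bounds are summable in r, so no
  subsequence argument or higher moment is required.\<close>

lemma (in prob_space) orthogonal_tree_avg_tendsto_0:
  fixes Y :: "nat \<Rightarrow> 'a \<Rightarrow> real"
  assumes int: "\<And>i j. 1 \<le> i \<Longrightarrow> 1 \<le> j \<Longrightarrow> integrable M (\<lambda>\<omega>. Y i \<omega> * Y j \<omega>)"
    and meas: "\<And>i. 1 \<le> i \<Longrightarrow> Y i \<in> borel_measurable M"
    and orth: "\<And>i j. 1 \<le> i \<Longrightarrow> i < j \<Longrightarrow> expectation (\<lambda>\<omega>. Y i \<omega> * Y j \<omega>) = 0"
    and bound: "\<And>i. 1 \<le> i \<Longrightarrow> expectation (\<lambda>\<omega>. (Y i \<omega>)\<^sup>2) \<le> C"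
  shows "AE \<omega> in M. (\<lambda>r. tree_avg r (\<lambda>i. Y i \<omega>)) \<longlonglongrightarrow> 0"
proof -
  have ge1: "1 \<le> i" if "i \<in> tree r" for i r using that by (simp add: tree_def)
  have C: "0 \<le> C" using bound[of 1] by (rule order_trans[rotated]) simp_all
  define f where "f r \<omega> = (tree_avg r (\<lambda>i. Y i \<omega>))\<^sup>2" for r \<omega>
  have f: "integrable M (f r)" and Ef: "expectation (f r) \<le> C * (1 / 2) ^ r" for r
  proof -
    let ?N = "real (card (tree r))"
    have eq: "f r = (\<lambda>\<omega>. (\<Sum>i\<in>tree r. \<Sum>j\<in>tree r. Y i \<omega> * Y j \<omega>) / ?N\<^sup>2)"
      by (simp add: fun_eq_iff f_def tree_avg_def power_divide power2_eq_square sum_product)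
    show "integrable M (f r)" unfolding eq by (intro integrable_divide Bochner_Integration.integrable_sum int ge1)
    have off: "expectation (\<lambda>\<omega>. Y i \<omega> * Y j \<omega>) = 0" if "1 \<le> i" "1 \<le> j" "i \<noteq> j" for i j
      using that orth[of i j] orth[of j i] by (cases i j rule: linorder_cases) (simp_all add: mult.commute)
    have "expectation (f r) = (\<Sum>i\<in>tree r. \<Sum>j\<in>tree r. expectation (\<lambda>\<omega>. Y i \<omega> * Y j \<omega>)) / ?N\<^sup>2"
    proof -
      have "expectation (\<lambda>\<omega>. \<Sum>i\<in>tree r. \<Sum>j\<in>tree r. Y i \<omega> * Y j \<omega>) =
          (\<Sum>i\<in>tree r. expectation (\<lambda>\<omega>. \<Sum>j\<in>tree r. Y i \<omega> * Y j \<omega>))"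
        by (intro Bochner_Integration.integral_sum Bochner_Integration.integrable_sum int ge1)
      also have "\<dots> = (\<Sum>i\<in>tree r. \<Sum>j\<in>tree r. expectation (\<lambda>\<omega>. Y i \<omega> * Y j \<omega>))"
        by (intro sum.cong refl Bochner_Integration.integral_sum int ge1)
      finally show ?thesis unfolding eq by simp
    qed
    also have "(\<Sum>i\<in>tree r. \<Sum>j\<in>tree r. expectation (\<lambda>\<omega>. Y i \<omega> * Y j \<omega>)) =
        (\<Sum>i\<in>tree r. \<Sum>j\<in>tree r. if i = j then expectation (\<lambda>\<omega>. (Y i \<omega>)\<^sup>2) else 0)"
      by (intro sum.cong refl) (use off ge1 in \<open>auto simp: power2_eq_square\<close>)
    also have "\<dots> = (\<Sum>i\<in>tree r. expectation (\<lambda>\<omega>. (Y i \<omega>)\<^sup>2))" by simp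
    also have "\<dots> \<le> (\<Sum>i\<in>tree r. C)" by (intro sum_mono bound ge1)
    also have "\<dots> / ?N\<^sup>2 = C / ?N"
      using card_tree_pos[of r] by (simp add: power2_eq_square)
    also have "\<dots> \<le> C / 2 ^ r" using C card_tree_pos[of r] by (intro divide_left_mono card_tree_ge) auto
    finally show "expectation (f r) \<le> C * (1 / 2) ^ r"
      by (simp add: power_one_over divide_right_mono)
  qed
  have meas_f[measurable]: "f r \<in> borel_measurable M" for r using f by (rule borel_measurable_integrable)
  have nn: "0 \<le> f r \<omega>" for r \<omega> by (simp add: f_def)
  \<comment> \<open>The sum of the squared averages has finite expectation, hence is almost surely
    finite, and its terms tend to 0.\<close>
  have "(\<integral>\<^sup>+\<omega>. (\<Sum>r. ennreal (f r \<omega>)) \<partial>M) = (\<Sum>r. \<integral>\<^sup>+\<omega>. ennreal (f r \<omega>) \<partial>M)"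
    by (rule nn_integral_suminf) measurable
  also have "\<dots> = (\<Sum>r. ennreal (expectation (f r)))"
    using f nn by (simp add: nn_integral_eq_integral)
  also have "\<dots> \<le> (\<Sum>r. ennreal (C * (1 / 2) ^ r))"
    by (intro suminf_le ennreal_leI Ef) auto
  also have "\<dots> = ennreal (\<Sum>r. C * (1 / 2) ^ r)"
    using C by (intro suminf_ennreal2) (auto intro!: summable_mult summable_geometric)
  also have "\<dots> < \<infinity>" by simp
  finally have "AE \<omega> in M. (\<Sum>r. ennreal (f r \<omega>)) \<noteq> \<infinity>"
    by (intro nn_integral_PInf_AE) auto
  then show ?thesis
  proof eventually_elim
    case (elim \<omega>)
    then have "summable (\<lambda>r. f r \<omega>)" using nn by (intro summable_suminf_not_top) auto
    then have "(\<lambda>r. (tree_avg r (\<lambda>i. Y i \<omega>))\<^sup>2) \<longlonglongrightarrow> 0"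
      unfolding f_def by (rule summable_LIMSEQ_zero)
    then show ?case by (simp add: power_tendsto_0_iff)
  qed
qed

section \<open>Fourth moments\<close>

lemma (in prob_space) gaussian_fourth_moment:
  assumes Y: "gaussian_rv M Y" and mean: "expectation Y = 0"
    and var: "expectation (\<lambda>\<omega>. (Y \<omega>)\<^sup>2) = s" and s: "s > 0"
  shows "integrable M (\<lambda>\<omega>. (Y \<omega>) ^ 4) \<and> expectation (\<lambda>\<omega>. (Y \<omega>) ^ 4) = 3 * s\<^sup>2"
proof -
  have meas[measurable]: "Y \<in> borel_measurable M" using Y by (simp add: gaussian_rv_def)
  \<comment> \<open>An almost surely constant variable with mean 0 has second moment 0, against
    \<open>s > 0\<close>; this leaves the case of a normal density.\<close>
  have nonconst: "\<not> (\<exists>\<mu>. AE \<omega> in M. Y \<omega> = \<mu>)"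
  proof
    assume "\<exists>\<mu>. AE \<omega> in M. Y \<omega> = \<mu>"
    then obtain \<mu> where c: "AE \<omega> in M. Y \<omega> = \<mu>" ..
    have "expectation Y = expectation (\<lambda>_. \<mu>)" using c by (intro integral_cong_AE) auto
    then have "expectation Y = \<mu>" by (simp add: prob_space)
    moreover have "expectation (\<lambda>\<omega>. (Y \<omega>)\<^sup>2) = expectation (\<lambda>_. \<mu>\<^sup>2)"
      using c by (intro integral_cong_AE) auto
    then have "expectation (\<lambda>\<omega>. (Y \<omega>)\<^sup>2) = \<mu>\<^sup>2" by (simp add: prob_space)
    ultimately show False using mean var s by simp
  qed
  from Y have "\<exists>\<mu> t. t > 0 \<and> distributed M lborel Y (normal_density \<mu> t)"
    unfolding gaussian_rv_def using nonconst by (elim conjE disjE) simp_all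
  then obtain \<mu> t where t: "t > 0" and D: "distributed M lborel Y (normal_density \<mu> t)"
    by blast
  have \<mu>: "\<mu> = 0" using normal_distributed_expectation[OF t D] mean by simp
  have "t\<^sup>2 = s" using normal_distributed_variance[OF t D] mean var by simp
  \<comment> \<open>The moment of order 2 * 2 is 4! / (2^2 * 2!) = 3 times the squared
    variance.\<close>
  note m4 = normal_moment_even[OF t, of 0 2]
  have "integrable lborel (\<lambda>y. normal_density \<mu> t y * y ^ 4)"
    using m4 by (simp add: \<mu> has_bochner_integral_iff)
  then have "integrable M (\<lambda>\<omega>. (Y \<omega>) ^ 4)"
    by (subst (asm) distributed_integrable[OF D]) auto
  moreover have "expectation (\<lambda>\<omega>. (Y \<omega>) ^ 4) = 3 * s\<^sup>2"
    using distributed_integral[OF D, of "\<lambda>y. y ^ 4"] m4 \<open>t\<^sup>2 = s\<close>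
    by (simp add: \<mu> has_bochner_integral_iff fact_numeral power_divide)
  ultimately show ?thesis ..
qed

text \<open>The one integrability condition propagated through the tree: it makes products of up to
  four such variables integrable, which covers the second moments of all products of two.\<close>

definition has_fourth_moment :: "'a measure \<Rightarrow> ('a \<Rightarrow> real) \<Rightarrow> bool" where
  "has_fourth_moment M Y \<longleftrightarrow> Y \<in> borel_measurable M \<and> integrable M (\<lambda>\<omega>. Y \<omega> ^ 4)"

lemma (in prob_space) has_fourth_moment_const: "has_fourth_moment M (\<lambda>_. c)"
  by (simp add: has_fourth_moment_def)

lemma has_fourth_moment_cong:
  "has_fourth_moment M f \<Longrightarrow> (\<And>\<omega>. \<omega> \<in> space M \<Longrightarrow> g \<omega> = f \<omega>) \<Longrightarrow> has_fourth_moment M g"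
  unfolding has_fourth_moment_def
  by (simp cong: measurable_cong Bochner_Integration.integrable_cong)

lemma abs_mult4_le:
  fixes a b c d :: real
  shows "\<bar>a * b * c * d\<bar> \<le> a ^ 4 + b ^ 4 + c ^ 4 + d ^ 4"
proof -
  have le: "\<bar>x * y\<bar> \<le> x\<^sup>2 + y\<^sup>2" for x y :: real
  proof -
    have "2 * \<bar>x * y\<bar> \<le> x\<^sup>2 + y\<^sup>2"
      using sum_squares_bound[of "\<bar>x\<bar>" "\<bar>y\<bar>"] by (simp add: abs_mult)
    then show ?thesis using abs_ge_zero[of "x * y"] by linarith
  qed
  have p4: "x ^ 4 = (x\<^sup>2)\<^sup>2" for x :: real by simp
  have "\<bar>a * b * c * d\<bar> = \<bar>(a * b) * (c * d)\<bar>" by (simp add: mult.assoc)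
  also have "\<dots> \<le> (a * b)\<^sup>2 + (c * d)\<^sup>2" by (rule le)
  also have "\<dots> = \<bar>a\<^sup>2 * b\<^sup>2\<bar> + \<bar>c\<^sup>2 * d\<^sup>2\<bar>" by (simp add: power_mult_distrib)
  also have "\<dots> \<le> ((a\<^sup>2)\<^sup>2 + (b\<^sup>2)\<^sup>2) + ((c\<^sup>2)\<^sup>2 + (d\<^sup>2)\<^sup>2)" by (intro add_mono le)
  finally show ?thesis by (simp only: p4 add.assoc)
qed

lemma integrable_mult4:
  assumes "has_fourth_moment M a" "has_fourth_moment M b" "has_fourth_moment M c" "has_fourth_moment M d"
  shows "integrable M (\<lambda>\<omega>. a \<omega> * b \<omega> * c \<omega> * d \<omega>)"
proof (rule Bochner_Integration.integrable_bound)
  show "integrable M (\<lambda>\<omega>. a \<omega> ^ 4 + b \<omega> ^ 4 + c \<omega> ^ 4 + d \<omega> ^ 4)"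
    using assms by (simp add: has_fourth_moment_def)
  show "(\<lambda>\<omega>. a \<omega> * b \<omega> * c \<omega> * d \<omega>) \<in> borel_measurable M"
    using assms unfolding has_fourth_moment_def by (intro borel_measurable_times) simp_all
  show "AE \<omega> in M. norm (a \<omega> * b \<omega> * c \<omega> * d \<omega>) \<le> norm (a \<omega> ^ 4 + b \<omega> ^ 4 + c \<omega> ^ 4 + d \<omega> ^ 4)"
    unfolding real_norm_def by (intro AE_I2 order_trans[OF abs_mult4_le abs_ge_self])
qed

lemma (in prob_space) has_fourth_moment_integrable:
  assumes "has_fourth_moment M a" "has_fourth_moment M b"
  shows "integrable M a" "integrable M (\<lambda>\<omega>. a \<omega> * b \<omega>)" "integrable M (\<lambda>\<omega>. (a \<omega>)\<^sup>2)"
proof -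
  note one = has_fourth_moment_const[of 1]
  show "integrable M a" using integrable_mult4[OF assms(1) one one one] by simp
  show "integrable M (\<lambda>\<omega>. a \<omega> * b \<omega>)" using integrable_mult4[OF assms one one] by simp
  show "integrable M (\<lambda>\<omega>. (a \<omega>)\<^sup>2)"
    using integrable_mult4[OF assms(1,1) one one] by (simp add: power2_eq_square)
qed

text \<open>Convexity of the fourth power, with weights \<open>\<bar>\<alpha>\<bar>\<close> and
  \<open>1 - \<bar>\<alpha>\<bar>\<close>, keeps a factor below 1 in front of \<open>x ^ 4\<close>.
  Expanding the power instead would leave mixed terms to control.\<close>

lemma power4_affine_le:
  fixes \<alpha> \<beta> x e :: real
  assumes "\<bar>\<alpha>\<bar> < 1"
  shows "(\<alpha> * x + \<beta> + e) ^ 4 \<le>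
    \<bar>\<alpha>\<bar> * x ^ 4 + (1 - \<bar>\<alpha>\<bar>) * ((8 * \<beta> ^ 4 + 8 * e ^ 4) / (1 - \<bar>\<alpha>\<bar>) ^ 4)"
proof -
  have conv: "((1 - t) * y + t * z) ^ 4 \<le> (1 - t) * y ^ 4 + t * z ^ 4"
    if "0 \<le> t" "t \<le> 1" for t y z :: real
    using convex_onD[OF convex_power_even[of 4] that, of y z] by simp
  \<comment> \<open>The sign of \<open>\<alpha>\<close> moves into the first point so that its
    weight is nonnegative; dividing by \<open>1 - \<bar>\<alpha>\<bar>\<close> compensates the
    weight of the second.\<close>
  have "\<alpha> * x + \<beta> + e = (1 - (1 - \<bar>\<alpha>\<bar>)) * (sgn \<alpha> * x) + (1 - \<bar>\<alpha>\<bar>) * ((\<beta> + e) / (1 - \<bar>\<alpha>\<bar>))"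
  proof -
    have "\<bar>\<alpha>\<bar> * (sgn \<alpha> * x) = \<alpha> * x" by (simp add: sgn_if)
    moreover have "(1 - \<bar>\<alpha>\<bar>) * ((\<beta> + e) / (1 - \<bar>\<alpha>\<bar>)) = \<beta> + e" using assms by simp
    moreover have "1 - (1 - \<bar>\<alpha>\<bar>) = \<bar>\<alpha>\<bar>" by simp
    ultimately show ?thesis by (simp only: add.assoc)
  qed
  also have "\<dots> ^ 4 \<le> (1 - (1 - \<bar>\<alpha>\<bar>)) * (sgn \<alpha> * x) ^ 4 + (1 - \<bar>\<alpha>\<bar>) * ((\<beta> + e) / (1 - \<bar>\<alpha>\<bar>)) ^ 4"
    using assms by (intro conv) auto
  also have "\<dots> \<le> \<bar>\<alpha>\<bar> * x ^ 4 + (1 - \<bar>\<alpha>\<bar>) * ((8 * \<beta> ^ 4 + 8 * e ^ 4) / (1 - \<bar>\<alpha>\<bar>) ^ 4)"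
  proof (intro add_mono)
    show "(1 - (1 - \<bar>\<alpha>\<bar>)) * (sgn \<alpha> * x) ^ 4 \<le> \<bar>\<alpha>\<bar> * x ^ 4"
      by (simp add: sgn_if)
    \<comment> \<open>Convexity at the midpoint of \<open>2 * \<beta>\<close> and
      \<open>2 * e\<close>; the constant 8 is 2^4 / 2.\<close>
    have "((1 - 1 / 2) * (2 * \<beta>) + 1 / 2 * (2 * e)) ^ 4 \<le> (1 - 1 / 2) * (2 * \<beta>) ^ 4 + 1 / 2 * (2 * e) ^ 4"
      by (rule conv) simp_all
    then have "(\<beta> + e) ^ 4 \<le> 8 * \<beta> ^ 4 + 8 * e ^ 4" by (simp add: power_mult_distrib)
    then show "(1 - \<bar>\<alpha>\<bar>) * ((\<beta> + e) / (1 - \<bar>\<alpha>\<bar>)) ^ 4 \<le>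
        (1 - \<bar>\<alpha>\<bar>) * ((8 * \<beta> ^ 4 + 8 * e ^ 4) / (1 - \<bar>\<alpha>\<bar>) ^ 4)"
      using assms unfolding power_divide by (intro mult_left_mono divide_right_mono) auto
  qed
  finally show ?thesis .
qed

text \<open>The bound is a convex combination of the fourth moment of \<open>x\<close> and a
  quantity independent of \<open>x\<close>, so any constant dominating both also bounds the new
  fourth moment.\<close>

lemma (in prob_space) has_fourth_moment_affine:
  assumes x: "has_fourth_moment M x" and e: "has_fourth_moment M e" and \<alpha>: "\<bar>\<alpha>\<bar> < 1"
  shows "has_fourth_moment M (\<lambda>\<omega>. \<alpha> * x \<omega> + \<beta> + e \<omega>)"
    and "expectation (\<lambda>\<omega>. (\<alpha> * x \<omega> + \<beta> + e \<omega>) ^ 4) \<le> \<bar>\<alpha>\<bar> * expectation (\<lambda>\<omega>. x \<omega> ^ 4)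
      + (1 - \<bar>\<alpha>\<bar>) * ((8 * \<beta> ^ 4 + 8 * expectation (\<lambda>\<omega>. e \<omega> ^ 4)) / (1 - \<bar>\<alpha>\<bar>) ^ 4)"
proof -
  let ?g = "\<lambda>\<omega>. \<bar>\<alpha>\<bar> * x \<omega> ^ 4 + (1 - \<bar>\<alpha>\<bar>) * ((8 * \<beta> ^ 4 + 8 * e \<omega> ^ 4) / (1 - \<bar>\<alpha>\<bar>) ^ 4)"
  have [measurable]: "x \<in> borel_measurable M" "e \<in> borel_measurable M"
    and int: "integrable M (\<lambda>\<omega>. x \<omega> ^ 4)" "integrable M (\<lambda>\<omega>. e \<omega> ^ 4)"
    using x e by (auto simp: has_fourth_moment_def)
  have g: "integrable M ?g"
    by (intro Bochner_Integration.integrable_add integrable_mult_right integrable_divide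
        integrable_const int)
  have le: "(\<alpha> * x \<omega> + \<beta> + e \<omega>) ^ 4 \<le> ?g \<omega>" for \<omega>
    by (rule power4_affine_le[OF \<alpha>])
  have int': "integrable M (\<lambda>\<omega>. (\<alpha> * x \<omega> + \<beta> + e \<omega>) ^ 4)"
  proof (rule Bochner_Integration.integrable_bound[OF g])
    have "norm ((\<alpha> * x \<omega> + \<beta> + e \<omega>) ^ 4) \<le> norm (?g \<omega>)" for \<omega>
    proof -
      have "norm ((\<alpha> * x \<omega> + \<beta> + e \<omega>) ^ 4) = (\<alpha> * x \<omega> + \<beta> + e \<omega>) ^ 4" by simp
      then show ?thesis using le[of \<omega>] unfolding real_norm_def by linarith
    qed
    then show "AE \<omega> in M. norm ((\<alpha> * x \<omega> + \<beta> + e \<omega>) ^ 4) \<le> norm (?g \<omega>)" by (rule AE_I2)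
  qed measurable
  then show "has_fourth_moment M (\<lambda>\<omega>. \<alpha> * x \<omega> + \<beta> + e \<omega>)"
    by (simp add: has_fourth_moment_def)
  have "expectation (\<lambda>\<omega>. (\<alpha> * x \<omega> + \<beta> + e \<omega>) ^ 4) \<le> expectation ?g"
    by (intro integral_mono int' g le)
  also have "\<dots> = \<bar>\<alpha>\<bar> * expectation (\<lambda>\<omega>. x \<omega> ^ 4)
      + (1 - \<bar>\<alpha>\<bar>) * ((8 * \<beta> ^ 4 + 8 * expectation (\<lambda>\<omega>. e \<omega> ^ 4)) / (1 - \<bar>\<alpha>\<bar>) ^ 4)"
    using int by (simp add: prob_space)
  finally show "expectation (\<lambda>\<omega>. (\<alpha> * x \<omega> + \<beta> + e \<omega>) ^ 4) \<le> \<bar>\<alpha>\<bar> * expectation (\<lambda>\<omega>. x \<omega> ^ 4)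
      + (1 - \<bar>\<alpha>\<bar>) * ((8 * \<beta> ^ 4 + 8 * expectation (\<lambda>\<omega>. e \<omega> ^ 4)) / (1 - \<bar>\<alpha>\<bar>) ^ 4)" .
qed

section \<open>Independence in the model\<close>

lemma borel_measurable_vector_2:
  fixes f :: "'b \<Rightarrow> real"
  assumes "f \<in> borel_measurable N"
  shows "(\<lambda>\<omega>. vector [f \<omega>, 0] :: real ^ 2) \<in> borel_measurable N"
proof -
  have "(\<lambda>\<omega>. vector [f \<omega>, 0] :: real ^ 2) = (\<lambda>\<omega>. f \<omega> *\<^sub>R axis 1 1)"
    by (auto simp: fun_eq_iff vec_eq_iff forall_2 axis_def)
  then show ?thesis using assms by simp
qed

lemma borel_measurable_vec_component [measurable]: "(\<lambda>z :: real ^ 2. z $ j) \<in> borel_measurable borel"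
  by (intro borel_measurable_continuous_onI continuous_intros)

lemma vertex_cases:
  fixes k :: nat
  assumes "1 \<le> k"
  obtains "k = 1"
  | n where "1 \<le> n" "n < k" "k = 2 * n"
  | n where "1 \<le> n" "n < k" "k = 2 * n + 1"
proof -
  consider "k = 1" | "1 \<le> k div 2" "k div 2 < k" "k = 2 * (k div 2)"
    | "1 \<le> k div 2" "k div 2 < k" "k = 2 * (k div 2) + 1"
    using assms by linarith
  then show thesis using that by cases blast+
qed

context bar_model
begin

text \<open>The ancestor is padded to a vector because \<open>indep_var_restrict\<close> needs all variables of a
  family to have the same type.\<close>

definition source :: "nat \<Rightarrow> 'a \<Rightarrow> real ^ 2" where
  "source n = (if n = 0 then (\<lambda>\<omega>. vector [X 1 \<omega>, 0]) else noise eps n)"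

lemma noise_measurable: "1 \<le> n \<Longrightarrow> noise eps n \<in> borel_measurable M"
  using noise_gaussian by (simp add: gaussian_vector_def)

lemma source_measurable: "source n \<in> borel_measurable M"
  unfolding source_def using noise_measurable[of n] borel_measurable_vector_2[OF X_1_measurable] by simp

text \<open>Joins the two independence assumptions of the model: the factor of the ancestor is split
  off by its independence of the whole noise process, and the remaining product comes from the
  independence of the noises.\<close>

lemma indep_source: "indep_vars (\<lambda>_. borel) source UNIV"
  unfolding indep_vars_def2
proof (intro conjI ballI source_measurable indep_setsI)
  fix i :: nat
  show "{source i -` A \<inter> space M |A. A \<in> sets borel} \<subseteq> events"
    using source_measurable[of i] by (auto intro: measurable_sets)
next
  fix A :: "nat \<Rightarrow> 'a set" and J :: "nat set"
  assume J: "J \<noteq> {}" "finite J"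
    and A: "\<forall>j\<in>J. A j \<in> {source j -` B \<inter> space M |B. B \<in> sets borel}"
  have noise_prod: "prob (\<Inter>j\<in>K. A j) = (\<Prod>j\<in>K. prob (A j))" if K: "K \<subseteq> J - {0}" "K \<noteq> {}" for K
  proof (rule indep_setsD)
    show "indep_sets (\<lambda>i. {noise eps i -` B \<inter> space M |B. B \<in> sets borel}) {1..}"
      using noise_indep unfolding indep_vars_def2 by simp
    show "K \<subseteq> {1..}" using K by (force simp: Suc_le_eq)
    show "finite K" using K J by (meson finite_Diff finite_subset)
    show "\<forall>j\<in>K. A j \<in> {noise eps j -` B \<inter> space M |B. B \<in> sets borel}"
    proof
      fix j assume "j \<in> K"
      then have "j \<in> J" "source j = noise eps j" using K by (auto simp: source_def)
      then show "A j \<in> {noise eps j -` B \<inter> space M |B. B \<in> sets borel}" using A by force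
    qed
  qed (rule K)
  show "prob (\<Inter>j\<in>J. A j) = (\<Prod>j\<in>J. prob (A j))"
  \<comment> \<open>If the ancestor is absent, the noises alone settle the claim; if it is alone,
    there is nothing to factor.\<close>
  proof (cases "0 \<in> J \<and> J \<noteq> {0}")
    case False
    then show ?thesis using noise_prod[of J] J by (cases "J = {0}") auto
  next
    case True
    define K where "K = J - {0}"
    have K: "K \<noteq> {}" "finite K" "K \<subseteq> {1..}" using True J by (auto simp: K_def Suc_le_eq)
    have "\<forall>j\<in>K. \<exists>B. B \<in> sets borel \<and> A j = noise eps j -` B \<inter> space M"
    proof
      fix j assume "j \<in> K"
      then have "j \<in> J" "source j = noise eps j" by (auto simp: source_def K_def)
      then show "\<exists>B. B \<in> sets borel \<and> A j = noise eps j -` B \<inter> space M" using A by force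
    qed
    then obtain B where B: "\<And>j. j \<in> K \<Longrightarrow> B j \<in> sets borel"
      "\<And>j. j \<in> K \<Longrightarrow> A j = noise eps j -` B j \<inter> space M" by metis
    let ?P = "Pi\<^sub>M {1..} (\<lambda>_. borel) :: (nat \<Rightarrow> real ^ 2) measure"
    have "prob (A 0 \<inter> (\<Inter>j\<in>K. A j)) = prob (A 0) * prob (\<Inter>j\<in>K. A j)"
    proof (rule indep_setD[OF noise_indep_X_1])
      obtain C where C: "C \<in> sets borel" "A 0 = source 0 -` C \<inter> space M" using A True by blast
      have "(\<lambda>x :: real. vector [x, 0] :: real ^ 2) -` C \<inter> space borel \<in> sets borel"
        by (rule measurable_sets[OF _ C(1)]) (rule borel_measurable_vector_2, simp)
      moreover have "A 0 = X 1 -` ((\<lambda>x :: real. vector [x, 0] :: real ^ 2) -` C \<inter> space borel) \<inter> space M"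
        unfolding C(2) by (auto simp: source_def)
      ultimately show "A 0 \<in> {X 1 -` A \<inter> space M | A. A \<in> sets borel}" by blast
      \<comment> \<open>Finitely many noise events are combined into one cylinder set, which makes
        their intersection an event of the whole noise process.\<close>
      let ?B = "\<Inter>j\<in>K. (\<lambda>z. z j) -` B j \<inter> space ?P"
      have "?B \<in> sets ?P"
        using K B(1) by (intro sets.finite_INT measurable_sets[OF measurable_component_singleton]) auto
      moreover have "(\<Inter>j\<in>K. A j) = (\<lambda>\<omega>. \<lambda>n\<in>{1..}. noise eps n \<omega>) -` ?B \<inter> space M"
      proof -
        have "(\<lambda>n\<in>{1..}. noise eps n \<omega>) \<in> space ?P" for \<omega> by (simp add: space_PiM)
        moreover have "(\<lambda>n\<in>{1..}. noise eps n \<omega>) j = noise eps j \<omega>" if "j \<in> K" for j \<omega>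
          using that K(3) by auto
        ultimately show ?thesis using B(2) K(1) by auto
      qed
      ultimately show "(\<Inter>j\<in>K. A j) \<in>
          {(\<lambda>\<omega>. \<lambda>n\<in>{1..}. noise eps n \<omega>) -` B \<inter> space M | B. B \<in> sets ?P}" by blast
    qed
    also have "prob (\<Inter>j\<in>K. A j) = (\<Prod>j\<in>K. prob (A j))" using K by (intro noise_prod) (auto simp: K_def)
    also have "A 0 \<inter> (\<Inter>j\<in>K. A j) = (\<Inter>j\<in>J. A j)" using True by (auto simp: K_def)
    also have "prob (A 0) * (\<Prod>j\<in>K. prob (A j)) = (\<Prod>j\<in>J. prob (A j))"
      using True J unfolding K_def by (intro prod.remove[symmetric]) auto
    finally show ?thesis .
  qed
qed

text \<open>\<open>noise eps n\<close> drives the daughters \<open>2 * n\<close> and \<open>2 * n + 1\<close>, whence the strict bound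
  \<open>n < i\<close> in \<open>past i\<close>: \<open>X i\<close> itself belongs to \<open>past i\<close>.\<close>

definition past :: "nat \<Rightarrow> ('a \<Rightarrow> real) \<Rightarrow> bool" where
  "past i Y \<longleftrightarrow> (\<exists>g \<in> borel_measurable (Pi\<^sub>M {..<i} (\<lambda>_. borel)).
     \<forall>\<omega>\<in>space M. Y \<omega> = g (\<lambda>n\<in>{..<i}. source n \<omega>))"

lemma past_const: "past i (\<lambda>_. c)"
  unfolding past_def by (rule bexI[of _ "\<lambda>_. c"]) auto

lemma past_add:
  assumes "past i Y" "past i Z"
  shows "past i (\<lambda>\<omega>. Y \<omega> + Z \<omega>)"
proof -
  obtain g h where "g \<in> borel_measurable (Pi\<^sub>M {..<i} (\<lambda>_. borel))"
    "h \<in> borel_measurable (Pi\<^sub>M {..<i} (\<lambda>_. borel))"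
    "\<forall>\<omega>\<in>space M. Y \<omega> = g (\<lambda>n\<in>{..<i}. source n \<omega>)" "\<forall>\<omega>\<in>space M. Z \<omega> = h (\<lambda>n\<in>{..<i}. source n \<omega>)"
    using assms unfolding past_def by blast
  then show ?thesis unfolding past_def by (intro bexI[of _ "\<lambda>z. g z + h z"]) auto
qed

lemma past_mult:
  assumes "past i Y" "past i Z"
  shows "past i (\<lambda>\<omega>. Y \<omega> * Z \<omega>)"
proof -
  obtain g h where "g \<in> borel_measurable (Pi\<^sub>M {..<i} (\<lambda>_. borel))"
    "h \<in> borel_measurable (Pi\<^sub>M {..<i} (\<lambda>_. borel))"
    "\<forall>\<omega>\<in>space M. Y \<omega> = g (\<lambda>n\<in>{..<i}. source n \<omega>)" "\<forall>\<omega>\<in>space M. Z \<omega> = h (\<lambda>n\<in>{..<i}. source n \<omega>)"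
    using assms unfolding past_def by blast
  then show ?thesis unfolding past_def by (intro bexI[of _ "\<lambda>z. g z * h z"]) auto
qed

lemma past_source:
  assumes "f \<in> borel_measurable borel" "n < i"
  shows "past i (\<lambda>\<omega>. f (source n \<omega>))"
  unfolding past_def
proof (rule bexI[of _ "\<lambda>z. f (z n)"])
  show "(\<lambda>z. f (z n)) \<in> borel_measurable (Pi\<^sub>M {..<i} (\<lambda>_. borel))"
    using assms by (intro measurable_compose[OF measurable_component_singleton]) auto
qed (use assms in auto)

lemma past_noise:
  assumes "f \<in> borel_measurable borel" "1 \<le> n" "n < i"
  shows "past i (\<lambda>\<omega>. f (noise eps n \<omega>))"
  using past_source[OF assms(1,3)] assms(2) by (simp add: source_def)

lemma past_cong:
  "past i Y \<Longrightarrow> (\<And>\<omega>. \<omega> \<in> space M \<Longrightarrow> Z \<omega> = Y \<omega>) \<Longrightarrow> past i Z"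
  unfolding past_def by simp

lemma noise_components: "noise eps n \<omega> $ 1 = eps (2 * n) \<omega>" "noise eps n \<omega> $ 2 = eps (2 * n + 1) \<omega>"
  by (simp_all add: noise_def)

text \<open>Strong induction along the ancestors: the mother \<open>n\<close> of \<open>k\<close>
  satisfies \<open>n < k\<close>, so the noise producing \<open>X k\<close> has index below
  \<open>k\<close> and hence below \<open>i\<close>.\<close>

lemma past_X: "1 \<le> k \<Longrightarrow> k \<le> i \<Longrightarrow> past i (X k)"
proof (induction k rule: less_induct)
  case (less k)
  from less.prems(1) show ?case
  proof (cases k rule: vertex_cases)
    case 1
    have "past i (\<lambda>\<omega>. source 0 \<omega> $ 1)" using less.prems by (intro past_source) auto
    then show ?thesis using 1 by (simp add: source_def)
  next
    case (2 n)
    then have "past i (X n)" "past i (\<lambda>\<omega>. noise eps n \<omega> $ 1)"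
      using less.IH[of n] less.prems by (auto intro: past_noise)
    then have "past i (\<lambda>\<omega>. \<alpha>\<^sub>0 * X n \<omega> + \<beta>\<^sub>0 + noise eps n \<omega> $ 1)"
      by (intro past_add past_mult past_const)
    then show ?thesis
      by (rule past_cong) (use 2 X_even[of n] in \<open>simp add: noise_components\<close>)
  next
    case (3 n)
    then have "past i (X n)" "past i (\<lambda>\<omega>. noise eps n \<omega> $ 2)"
      using less.IH[of n] less.prems by (auto intro: past_noise)
    then have "past i (\<lambda>\<omega>. \<alpha>\<^sub>1 * X n \<omega> + \<beta>\<^sub>1 + noise eps n \<omega> $ 2)"
      by (intro past_add past_mult past_const)
    then show ?thesis
      by (rule past_cong) (use 3 X_odd[of n] in \<open>simp add: noise_components\<close>)
  qed
qed

text \<open>The martingale increment property: \<open>Y\<close> depends on sources with index below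
  \<open>i\<close>, which are jointly independent of source \<open>i\<close>, so the expectation
  factors and the centred factor is 0.\<close>

lemma expectation_past_mult_noise:
  assumes i: "1 \<le> i" and Y: "past i Y" and f: "f \<in> borel_measurable borel"
    and int: "integrable M Y" "integrable M (\<lambda>\<omega>. f (noise eps i \<omega>))"
    and mean: "expectation (\<lambda>\<omega>. f (noise eps i \<omega>)) = 0"
  shows "expectation (\<lambda>\<omega>. Y \<omega> * f (noise eps i \<omega>)) = 0"
proof -
  obtain g where g: "g \<in> borel_measurable (Pi\<^sub>M {..<i} (\<lambda>_. borel))"
    "\<And>\<omega>. \<omega> \<in> space M \<Longrightarrow> Y \<omega> = g (\<lambda>n\<in>{..<i}. source n \<omega>)"
    using Y unfolding past_def by blast
  let ?Y = "\<lambda>\<omega>. g (\<lambda>n\<in>{..<i}. source n \<omega>)" and ?F = "\<lambda>\<omega>. f (noise eps i \<omega>)"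
  have "indep_var (Pi\<^sub>M {..<i} (\<lambda>_. borel)) (\<lambda>\<omega>. \<lambda>n\<in>{..<i}. source n \<omega>)
      (Pi\<^sub>M {i} (\<lambda>_. borel)) (\<lambda>\<omega>. \<lambda>n\<in>{i}. source n \<omega>)"
    by (rule indep_var_restrict[OF indep_source]) auto
  moreover have "(\<lambda>z. f (z i)) \<in> borel_measurable (Pi\<^sub>M {i} (\<lambda>_. borel))"
    using f by (intro measurable_compose[OF measurable_component_singleton]) auto
  ultimately have "indep_var borel (g \<circ> (\<lambda>\<omega>. \<lambda>n\<in>{..<i}. source n \<omega>))
      borel ((\<lambda>z. f (z i)) \<circ> (\<lambda>\<omega>. \<lambda>n\<in>{i}. source n \<omega>))"
    by (rule indep_var_compose[OF _ g(1)])
  then have "indep_var borel ?Y borel ?F"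
    using i by (simp add: comp_def source_def)
  moreover have "integrable M ?Y"
    using int(1) by (rule Bochner_Integration.integrable_cong[THEN iffD1, rotated 2]) (simp_all add: g(2))
  ultimately have "expectation (\<lambda>\<omega>. ?Y \<omega> * ?F \<omega>) = expectation ?Y * expectation ?F"
    using int(2) by (rule indep_var_lebesgue_integral)
  then have "expectation (\<lambda>\<omega>. ?Y \<omega> * ?F \<omega>) = 0" by (simp add: mean)
  moreover have "expectation (\<lambda>\<omega>. Y \<omega> * ?F \<omega>) = expectation (\<lambda>\<omega>. ?Y \<omega> * ?F \<omega>)"
    by (intro Bochner_Integration.integral_cong refl) (simp add: g(2))
  ultimately show ?thesis by simp
qed

section \<open>Almost sure limits\<close>

lemma noise_component_mean: "1 \<le> n \<Longrightarrow> expectation (\<lambda>\<omega>. noise eps n \<omega> $ j) = 0"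
  using noise_gaussian[of n] by (simp add: gaussian_vector_def)

lemma noise_component_cov:
  assumes "1 \<le> n"
  shows "expectation (\<lambda>\<omega>. noise eps n \<omega> $ i * noise eps n \<omega> $ j) = (if i = j then \<sigma>2 else \<sigma>2 * \<rho>)"
proof -
  have "\<forall>i j. expectation (\<lambda>\<omega>. noise eps n \<omega> $ i * noise eps n \<omega> $ j) =
      (\<sigma>2 *\<^sub>R vector [vector [1, \<rho>], vector [\<rho>, 1]] :: real ^ 2 ^ 2) $ i $ j"
    using noise_gaussian[OF assms] unfolding gaussian_vector_def by simp
  then have "\<forall>i j. expectation (\<lambda>\<omega>. noise eps n \<omega> $ i * noise eps n \<omega> $ j) =
      (if i = j then \<sigma>2 else \<sigma>2 * \<rho>)"
    unfolding forall_2 by simp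
  then show ?thesis by blast
qed

lemma noise_component_fourth_moment:
  assumes "1 \<le> n"
  shows "has_fourth_moment M (\<lambda>\<omega>. noise eps n \<omega> $ j)"
    and "expectation (\<lambda>\<omega>. (noise eps n \<omega> $ j) ^ 4) = 3 * \<sigma>2\<^sup>2"
proof -
  have "gaussian_rv M (\<lambda>\<omega>. axis j 1 \<bullet> noise eps n \<omega>)"
    using noise_gaussian[OF assms] unfolding gaussian_vector_def by blast
  then have G: "gaussian_rv M (\<lambda>\<omega>. noise eps n \<omega> $ j)" by (simp add: inner_axis')
  have "expectation (\<lambda>\<omega>. (noise eps n \<omega> $ j)\<^sup>2) = \<sigma>2"
    using noise_component_cov[OF assms, of j j] by (simp add: power2_eq_square)
  note F = gaussian_fourth_moment[OF G noise_component_mean[OF assms] this \<sigma>2]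
  show "has_fourth_moment M (\<lambda>\<omega>. noise eps n \<omega> $ j)"
    using F G by (simp add: has_fourth_moment_def gaussian_rv_def)
  show "expectation (\<lambda>\<omega>. (noise eps n \<omega> $ j) ^ 4) = 3 * \<sigma>2\<^sup>2" using F by simp
qed

text \<open>Induction from mother to daughter: the bound passes to a daughter as a convex
  combination of two quantities that are at most \<open>C\<close>.\<close>

lemma X_fourth_moment:
  assumes X1: "has_fourth_moment M (X 1)"
  shows "\<exists>C. \<forall>k\<ge>1. has_fourth_moment M (X k) \<and> expectation (\<lambda>\<omega>. X k \<omega> ^ 4) \<le> C"
proof -
  define K where "K \<alpha> \<beta> = (8 * \<beta> ^ 4 + 8 * (3 * \<sigma>2\<^sup>2)) / (1 - \<bar>\<alpha>\<bar>) ^ 4" for \<alpha> \<beta> :: real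
  \<comment> \<open>Dominates the fourth moment at the root and the constant term of the recursive
    bound for either kind of daughter.\<close>
  define C where "C = max (expectation (\<lambda>\<omega>. X 1 \<omega> ^ 4)) (max (K \<alpha>\<^sub>0 \<beta>\<^sub>0) (K \<alpha>\<^sub>1 \<beta>\<^sub>1))"
  have step: "has_fourth_moment M (X k) \<and> expectation (\<lambda>\<omega>. X k \<omega> ^ 4) \<le> C"
    if n: "1 \<le> n" "has_fourth_moment M (X n)" "expectation (\<lambda>\<omega>. X n \<omega> ^ 4) \<le> C"
      and X: "\<And>\<omega>. \<omega> \<in> space M \<Longrightarrow> X k \<omega> = \<alpha> * X n \<omega> + \<beta> + noise eps n \<omega> $ j"
      and \<alpha>: "\<bar>\<alpha>\<bar> < 1" and KC: "K \<alpha> \<beta> \<le> C"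
    for k n \<alpha> \<beta> j
  proof -
    note aff = has_fourth_moment_affine[OF n(2) noise_component_fourth_moment(1)[OF n(1), of j] \<alpha>, of \<beta>]
    have "has_fourth_moment M (X k)" using aff(1) by (rule has_fourth_moment_cong) (rule X)
    moreover have "expectation (\<lambda>\<omega>. X k \<omega> ^ 4) =
        expectation (\<lambda>\<omega>. (\<alpha> * X n \<omega> + \<beta> + noise eps n \<omega> $ j) ^ 4)"
      by (intro Bochner_Integration.integral_cong refl) (simp add: X)
    moreover have "\<dots> \<le> \<bar>\<alpha>\<bar> * expectation (\<lambda>\<omega>. X n \<omega> ^ 4) + (1 - \<bar>\<alpha>\<bar>) * K \<alpha> \<beta>"
      using aff(2) unfolding noise_component_fourth_moment(2)[OF n(1)] K_def .
    moreover have "\<dots> \<le> \<bar>\<alpha>\<bar> * C + (1 - \<bar>\<alpha>\<bar>) * C"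
      using n(3) \<alpha> KC by (intro add_mono mult_left_mono) simp_all
    moreover have "\<dots> = C" by (simp add: algebra_simps)
    ultimately show ?thesis by linarith
  qed
  have "has_fourth_moment M (X k) \<and> expectation (\<lambda>\<omega>. X k \<omega> ^ 4) \<le> C" if "1 \<le> k" for k
    using that
  proof (induction k rule: less_induct)
    case (less k)
    from less.prems show ?case
    proof (cases k rule: vertex_cases)
      case 1
      then show ?thesis using X1 by (simp add: C_def)
    next
      case (2 n)
      have "K \<alpha>\<^sub>0 \<beta>\<^sub>0 \<le> C" by (simp add: C_def)
      then show ?thesis using less.IH[of n] 2 \<alpha>\<^sub>0 X_even[of n]
        by (intro step[of n k \<alpha>\<^sub>0 \<beta>\<^sub>0 1]) (auto simp: noise_components)
    next
      case (3 n)
      have "K \<alpha>\<^sub>1 \<beta>\<^sub>1 \<le> C" by (simp add: C_def)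
      then show ?thesis using less.IH[of n] 3 \<alpha>\<^sub>1 X_odd[of n]
        by (intro step[of n k \<alpha>\<^sub>1 \<beta>\<^sub>1 2]) (auto simp: noise_components)
    qed
  qed
  then show ?thesis by blast
qed

text \<open>For i < j the product of \<open>Y i\<close> and the weight \<open>H j\<close> is
  determined by sources with index below j, so multiplying by the centred function of noise j gives
  expectation 0. This is the orthogonality required by the law of large numbers.\<close>

lemma increment_tree_avg_tendsto_0:
  fixes H :: "nat \<Rightarrow> 'a \<Rightarrow> real" and f :: "real ^ 2 \<Rightarrow> real"
  defines "Y \<equiv> \<lambda>i \<omega>. H i \<omega> * f (noise eps i \<omega>)"
  assumes H: "\<And>i j. 1 \<le> i \<Longrightarrow> i \<le> j \<Longrightarrow> past j (H i)" and f: "f \<in> borel_measurable borel"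
    and meas: "\<And>i. 1 \<le> i \<Longrightarrow> Y i \<in> borel_measurable M"
    and int: "\<And>i j. 1 \<le> i \<Longrightarrow> 1 \<le> j \<Longrightarrow> integrable M (\<lambda>\<omega>. Y i \<omega> * Y j \<omega>)"
      "\<And>i j. 1 \<le> i \<Longrightarrow> 1 \<le> j \<Longrightarrow> integrable M (\<lambda>\<omega>. Y i \<omega> * H j \<omega>)"
      "\<And>i. 1 \<le> i \<Longrightarrow> integrable M (\<lambda>\<omega>. f (noise eps i \<omega>))"
    and mean: "\<And>i. 1 \<le> i \<Longrightarrow> expectation (\<lambda>\<omega>. f (noise eps i \<omega>)) = 0"
    and bound: "\<And>i. 1 \<le> i \<Longrightarrow> expectation (\<lambda>\<omega>. (Y i \<omega>)\<^sup>2) \<le> C"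
  shows "AE \<omega> in M. (\<lambda>r. tree_avg r (\<lambda>i. Y i \<omega>)) \<longlonglongrightarrow> 0"
proof (rule orthogonal_tree_avg_tendsto_0[OF int(1) meas _ bound])
  fix i j :: nat assume ij: "1 \<le> i" "i < j"
  have "past j (\<lambda>\<omega>. Y i \<omega> * H j \<omega>)"
    unfolding Y_def using ij by (intro past_mult H past_noise f) auto
  then have "expectation (\<lambda>\<omega>. (Y i \<omega> * H j \<omega>) * f (noise eps j \<omega>)) = 0"
    using ij by (intro expectation_past_mult_noise f int mean) auto
  then show "expectation (\<lambda>\<omega>. Y i \<omega> * Y j \<omega>) = 0"
    by (simp add: Y_def mult.assoc)
qed

text \<open>Weights equal to 1 treat the noises themselves, weights \<open>X i\<close> their
  products with \<open>X\<close>.\<close>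

lemma weighted_noise_tree_avg_tendsto_0:
  assumes H: "\<And>i j. 1 \<le> i \<Longrightarrow> i \<le> j \<Longrightarrow> past j (H i)"
    and m4: "\<And>i. 1 \<le> i \<Longrightarrow> has_fourth_moment M (H i)"
    and C: "\<And>i. 1 \<le> i \<Longrightarrow> expectation (\<lambda>\<omega>. H i \<omega> ^ 4) \<le> C"
  shows "AE \<omega> in M. (\<lambda>r. tree_avg r (\<lambda>i. H i \<omega> * noise eps i \<omega> $ j)) \<longlonglongrightarrow> 0"
proof (rule increment_tree_avg_tendsto_0[OF H])
  note nm4 = noise_component_fourth_moment(1)
  note one = has_fourth_moment_const[of 1]
  show "(\<lambda>z :: real ^ 2. z $ j) \<in> borel_measurable borel" by measurable
  show "(\<lambda>\<omega>. H i \<omega> * noise eps i \<omega> $ j) \<in> borel_measurable M" if "1 \<le> i" for i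
    using m4[OF that] nm4[OF that, of j] unfolding has_fourth_moment_def
    by (intro borel_measurable_times) simp_all
  show "integrable M (\<lambda>\<omega>. (H i \<omega> * noise eps i \<omega> $ j) * (H k \<omega> * noise eps k \<omega> $ j))"
    if "1 \<le> i" "1 \<le> k" for i k
    using integrable_mult4[OF m4 nm4 m4 nm4, OF that(1,1,2,2)] by (simp add: mult.assoc)
  show "integrable M (\<lambda>\<omega>. (H i \<omega> * noise eps i \<omega> $ j) * H k \<omega>)" if "1 \<le> i" "1 \<le> k" for i k
    using integrable_mult4[OF m4 nm4 m4 one, OF that(1,1,2)] by simp
  show "integrable M (\<lambda>\<omega>. noise eps i \<omega> $ j)" if "1 \<le> i" for i
    using nm4[OF that] has_fourth_moment_integrable(1) one by blast
  show "expectation (\<lambda>\<omega>. noise eps i \<omega> $ j) = 0" if "1 \<le> i" for i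
    by (rule noise_component_mean[OF that])
  \<comment> \<open>The square is a product of four factors, each weight and each noise occurring
    twice, hence the coefficients 2; the noise has fourth moment
    \<open>3 * \<sigma>2\<^sup>2\<close>.\<close>
  show "expectation (\<lambda>\<omega>. (H i \<omega> * noise eps i \<omega> $ j)\<^sup>2) \<le> 2 * C + 2 * (3 * \<sigma>2\<^sup>2)" if "1 \<le> i" for i
  proof -
    have int: "integrable M (\<lambda>\<omega>. H i \<omega> ^ 4)" "integrable M (\<lambda>\<omega>. (noise eps i \<omega> $ j) ^ 4)"
      using m4[OF that] nm4[OF that, of j] by (simp_all add: has_fourth_moment_def)
    have "expectation (\<lambda>\<omega>. (H i \<omega> * noise eps i \<omega> $ j)\<^sup>2) \<le>
        expectation (\<lambda>\<omega>. 2 * H i \<omega> ^ 4 + 2 * (noise eps i \<omega> $ j) ^ 4)"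
    proof (intro integral_mono)
      show "integrable M (\<lambda>\<omega>. (H i \<omega> * noise eps i \<omega> $ j)\<^sup>2)"
        using integrable_mult4[OF m4 nm4 m4 nm4, OF that that that that, of j j]
        by (simp add: power2_eq_square mult.assoc)
      show "(H i \<omega> * noise eps i \<omega> $ j)\<^sup>2 \<le> 2 * H i \<omega> ^ 4 + 2 * (noise eps i \<omega> $ j) ^ 4" for \<omega>
        using abs_mult4_le[of "H i \<omega>" "noise eps i \<omega> $ j" "H i \<omega>" "noise eps i \<omega> $ j"]
        by (simp add: power2_eq_square mult.assoc)
    qed (use int in simp)
    also have "\<dots> = 2 * expectation (\<lambda>\<omega>. H i \<omega> ^ 4) + 2 * (3 * \<sigma>2\<^sup>2)"
      using int by (simp add: noise_component_fourth_moment(2)[OF that])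
    finally show ?thesis using C[OF that] by simp
  qed
qed

lemma noise_product_tree_avg_tendsto:
  "AE \<omega> in M. (\<lambda>r. tree_avg r (\<lambda>i. noise eps i \<omega> $ j * noise eps i \<omega> $ k))
     \<longlonglongrightarrow> (if j = k then \<sigma>2 else \<sigma>2 * \<rho>)"
proof -
  define c where "c = (if j = k then \<sigma>2 else \<sigma>2 * \<rho>)"
  note nm4 = noise_component_fourth_moment(1)
  have int: "integrable M (\<lambda>\<omega>. noise eps i \<omega> $ j * noise eps i \<omega> $ k)" if "1 \<le> i" for i
    by (intro has_fourth_moment_integrable(2) nm4 that)
  have int4: "integrable M (\<lambda>\<omega>. noise eps i \<omega> $ j * noise eps i \<omega> $ k * noise eps l \<omega> $ j * noise eps l \<omega> $ k)"
    if "1 \<le> i" "1 \<le> l" for i l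
    by (intro integrable_mult4 nm4 that)
  have "AE \<omega> in M. (\<lambda>r. tree_avg r (\<lambda>i. 1 * (noise eps i \<omega> $ j * noise eps i \<omega> $ k - c))) \<longlonglongrightarrow> 0"
  proof (rule increment_tree_avg_tendsto_0[where H = "\<lambda>_ _. 1" and f = "\<lambda>z. z $ j * z $ k - c"])
    show "(\<lambda>z :: real ^ 2. z $ j * z $ k - c) \<in> borel_measurable borel" by measurable
    show "(\<lambda>\<omega>. 1 * (noise eps i \<omega> $ j * noise eps i \<omega> $ k - c)) \<in> borel_measurable M" if "1 \<le> i" for i
      using int[OF that] by simp
    show int2: "integrable M (\<lambda>\<omega>. 1 * (noise eps i \<omega> $ j * noise eps i \<omega> $ k - c)
        * (1 * (noise eps l \<omega> $ j * noise eps l \<omega> $ k - c)))" if "1 \<le> i" "1 \<le> l" for i l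
    proof -
      have "integrable M (\<lambda>\<omega>. noise eps i \<omega> $ j * noise eps i \<omega> $ k * noise eps l \<omega> $ j * noise eps l \<omega> $ k
          - c * (noise eps i \<omega> $ j * noise eps i \<omega> $ k) - c * (noise eps l \<omega> $ j * noise eps l \<omega> $ k) + c * c)"
        by (intro Bochner_Integration.integrable_add Bochner_Integration.integrable_diff
            integrable_mult_right integrable_const int int4 that)
      then show ?thesis by (simp add: algebra_simps)
    qed
    show "integrable M (\<lambda>\<omega>. 1 * (noise eps i \<omega> $ j * noise eps i \<omega> $ k - c) * 1)" if "1 \<le> i" for i
      using int[OF that] by simp
    show "integrable M (\<lambda>\<omega>. noise eps i \<omega> $ j * noise eps i \<omega> $ k - c)" if "1 \<le> i" for i
      using int[OF that] by simp
    show "expectation (\<lambda>\<omega>. noise eps i \<omega> $ j * noise eps i \<omega> $ k - c) = 0" if "1 \<le> i" for i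
      using int[OF that] noise_component_cov[OF that] by (simp add: prob_space c_def)
    \<comment> \<open>The square of a difference is at most twice the sum of squares, and the
      squared product at most twice the sum of fourth powers; two fourth moments with coefficient 4
      give 24 = 4 * 3 + 4 * 3.\<close>
    show "expectation (\<lambda>\<omega>. (1 * (noise eps i \<omega> $ j * noise eps i \<omega> $ k - c))\<^sup>2) \<le> 24 * \<sigma>2\<^sup>2 + 2 * c\<^sup>2"
      if "1 \<le> i" for i
    proof -
      have int': "integrable M (\<lambda>\<omega>. (noise eps i \<omega> $ l) ^ 4)" for l
        using nm4[OF that, of l] by (simp add: has_fourth_moment_def)
      have "expectation (\<lambda>\<omega>. (1 * (noise eps i \<omega> $ j * noise eps i \<omega> $ k - c))\<^sup>2) \<le>
          expectation (\<lambda>\<omega>. 4 * (noise eps i \<omega> $ j) ^ 4 + 4 * (noise eps i \<omega> $ k) ^ 4 + 2 * c\<^sup>2)"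
      proof (intro integral_mono)
        show "integrable M (\<lambda>\<omega>. (1 * (noise eps i \<omega> $ j * noise eps i \<omega> $ k - c))\<^sup>2)"
          using int2[OF that that] by (simp add: power2_eq_square)
        show "(1 * (noise eps i \<omega> $ j * noise eps i \<omega> $ k - c))\<^sup>2 \<le>
            4 * (noise eps i \<omega> $ j) ^ 4 + 4 * (noise eps i \<omega> $ k) ^ 4 + 2 * c\<^sup>2" for \<omega>
        proof -
          let ?u = "noise eps i \<omega> $ j" and ?v = "noise eps i \<omega> $ k"
          have "(?u * ?v - c)\<^sup>2 \<le> 2 * (?u * ?v)\<^sup>2 + 2 * c\<^sup>2"
            using zero_le_power2[of "?u * ?v + c"] by (simp add: power2_eq_square algebra_simps)
          moreover have "(?u * ?v)\<^sup>2 \<le> 2 * ?u ^ 4 + 2 * ?v ^ 4"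
            using abs_mult4_le[of ?u ?v ?u ?v] by (simp add: power2_eq_square mult.assoc)
          ultimately show ?thesis by simp
        qed
      qed (use int' in simp)
      also have "\<dots> = 24 * \<sigma>2\<^sup>2 + 2 * c\<^sup>2"
        using int' by (simp add: noise_component_fourth_moment(2)[OF that] prob_space)
      finally show ?thesis .
    qed
  qed (rule past_const)
  then show ?thesis
    by eventually_elim (simp add: tree_avg_linear c_def[symmetric] LIM_zero_iff)
qed

lemma estimators_tendsto:
  assumes X1: "has_fourth_moment M (X 1)"
  shows "AE \<omega> in M.
    (\<lambda>r. (sigma2_hat (a r \<omega>) r (\<lambda>n. X n \<omega>), rho_hat (a r \<omega>) (b r \<omega>) r (\<lambda>n. X n \<omega>)))
      \<longlonglongrightarrow> (\<sigma>2, \<rho>)"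
proof -
  obtain C where C: "\<And>k. 1 \<le> k \<Longrightarrow> has_fourth_moment M (X k)"
    "\<And>k. 1 \<le> k \<Longrightarrow> expectation (\<lambda>\<omega>. X k \<omega> ^ 4) \<le> C"
    using X_fourth_moment[OF X1] by auto
  have noise0: "AE \<omega> in M. (\<lambda>r. tree_avg r (\<lambda>i. noise eps i \<omega> $ j)) \<longlonglongrightarrow> 0" for j
    using weighted_noise_tree_avg_tendsto_0[of "\<lambda>_ _. 1" 1 j]
    by (simp add: past_const has_fourth_moment_const prob_space)
  have Xnoise: "AE \<omega> in M. (\<lambda>r. tree_avg r (\<lambda>i. X i \<omega> * noise eps i \<omega> $ j)) \<longlonglongrightarrow> 0" for j
    by (intro weighted_noise_tree_avg_tendsto_0[where C = C] past_X C)
  \<comment> \<open>The model equations are available only for points of \<open>space M\<close>, so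
    this joins the almost sure events intersected below.\<close>
  have "AE \<omega> in M. \<omega> \<in> space M" by simp
  with noise0[of 1] noise0[of 2] Xnoise[of 1] Xnoise[of 2]
    noise_product_tree_avg_tendsto[of 1 1] noise_product_tree_avg_tendsto[of 2 2]
    noise_product_tree_avg_tendsto[of 1 2]
  show ?thesis
  proof eventually_elim
    case (elim \<omega>)
    show ?case
      by (rule bar_estimators_tendsto[where u = "\<lambda>n. noise eps n \<omega> $ 1" and v = "\<lambda>n. noise eps n \<omega> $ 2"
            and \<alpha>\<^sub>0 = \<alpha>\<^sub>0 and \<alpha>\<^sub>1 = \<alpha>\<^sub>1 and \<beta>\<^sub>0 = \<beta>\<^sub>0 and \<beta>\<^sub>1 = \<beta>\<^sub>1])
         (use elim \<alpha>\<^sub>0 \<alpha>\<^sub>1 \<sigma>2 X_even X_odd in \<open>auto simp: noise_components power2_eq_square\<close>)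
  qed
qed

end

theorem proposition34:
  fixes M :: "'a measure" and \<nu> :: "real measure"
    and X eps :: "nat \<Rightarrow> 'a \<Rightarrow> real"
    and \<alpha>\<^sub>0 \<alpha>\<^sub>1 \<beta>\<^sub>0 \<beta>\<^sub>1 \<sigma>2 \<rho> :: real
    and a :: "nat \<Rightarrow> 'a \<Rightarrow> nat \<Rightarrow> real" and b :: "nat \<Rightarrow> 'a \<Rightarrow> real"
  assumes "bar_model M \<nu> X eps \<alpha>\<^sub>0 \<alpha>\<^sub>1 \<beta>\<^sub>0 \<beta>\<^sub>1 \<sigma>2 \<rho>"
    and "\<And>k::nat. integrable \<nu> (\<lambda>x. \<bar>x\<bar> ^ k)"
  shows "AE \<omega> in M.
    (\<lambda>r. (sigma2_hat (a r \<omega>) r (\<lambda>n. X n \<omega>), rho_hat (a r \<omega>) (b r \<omega>) r (\<lambda>n. X n \<omega>)))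
      \<longlonglongrightarrow> (\<sigma>2, \<rho>)"
proof -
  interpret bar_model M \<nu> X eps \<alpha>\<^sub>0 \<alpha>\<^sub>1 \<beta>\<^sub>0 \<beta>\<^sub>1 \<sigma>2 \<rho> by fact
  have "integrable (distr M borel (X 1)) (\<lambda>x. \<bar>x\<bar> ^ 4)"
    unfolding X_1_distr by (rule assms(2))
  then have "integrable M (\<lambda>\<omega>. \<bar>X 1 \<omega>\<bar> ^ 4)"
    by (subst (asm) integrable_distr_eq) (use X_1_measurable in auto)
  then have "has_fourth_moment M (X 1)"
    using X_1_measurable by (simp add: has_fourth_moment_def power_even_abs)
  then show ?thesis by (rule estimators_tendsto)
qed

end
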